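(* Let $d\ge 3$ and let $(X(t))_{t\ge t_0}$ be the vertex-reinforced random walk on the complete-like graph $\mathcal G_d$ (with arbitrary leaf numbers $r_1,\dots,r_d\ge 0$ and arbitrary positive integer initial weights). Then $\mathbb P(\pi_\infty=\pi_{\mathsf{unif}})=1$.
   Context: Let $d\ge 2$ and $r_1,\dots,r_d\ge 0$ be integers. The complete-like graph $\mathcal G_d$ has vertex set $V_d=\{1,\dots,d\}\cup\{\ell^i_r: 1\le i\le d,\ 1\le r\le r_i\}$. The vertices $1,\dots,d$ are called interior, and every pair of distinct interior vertices is joined by an edge; for each $i$, the vertices $\ell^i_1,\dots,\ell^i_{r_i}$ are the leaves attached to $i$, each joined by an edge to $i$ only; there are no other edges. Write $v\sim w$ if $v,w$ are joined by an edge. Vertex-reinforced random walk (VRRW) on $\mathcal G_d$: fix positive integers $z(0,v)$, $v\in V_d$, put $t_0=\sum_{v\in V_d}z(0,v)$, let $X(t_0)\in V_d$ be a given starting vertex, and for $t\ge t_0$ let $Z(t,v)=z(0,v)+\#\{s\in\{t_0+1,\dots,t\}: X(s)=v\}$ (so $\sum_v Z(t,v)=t$). Let $\mathcal F_t=\sigma(X(s),t_0\le s\le t)$. The transitions are $\mathbb P(X(t+1)=w\mid\mathcal F_t)=Z(t,w)/\sum_{y\sim X(t)}Z(t,y)$ for $w\sim X(t)$. Let $\pi(t)=(Z(t,v)/t)_{v\in V_d}\in\mathbb R^{|V_d|}$ be the empirical occupation measure, let $\pi_\infty=\lim_{t\to\infty}\pi(t)$ on the event that this limit exists and $\pi_\infty=0$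 (zero vector) otherwise, and let $\pi_{\mathsf{unif}}\in\mathbb R^{|V_d|}$ be the vector with coordinate $1/d$ at each interior vertex and $0$ at each leaf. *)

theory Defs
  imports "HOL-Probability.Probability"
begin

datatype vtx = Inner nat | Leaf nat nat

definition verts :: "nat \<Rightarrow> (nat \<Rightarrow> nat) \<Rightarrow> vtx set" where
  "verts d r = {Inner i | i. 1 \<le> i \<and> i \<le> d}
              \<union> {Leaf i k | i k. 1 \<le> i \<and> i \<le> d \<and> 1 \<le> k \<and> k \<le> r i}"

fun adj :: "vtx \<Rightarrow> vtx \<Rightarrow> bool" where
  "adj (Inner i) (Inner j) = (i \<noteq> j)"
| "adj (Inner i) (Leaf j k) = (i = j)"
| "adj (Leaf j k) (Inner i) = (i = j)"
| "adj (Leaf i k) (Leaf j l) = False"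

definition tzero :: "nat \<Rightarrow> (nat \<Rightarrow> nat) \<Rightarrow> (vtx \<Rightarrow> nat) \<Rightarrow> nat" where
  "tzero d r z0 = (\<Sum>v\<in>verts d r. z0 v)"

text \<open>Weights after a history h = [X(t0), X(t0+1), ..., X(t0+n)].\<close>
definition Zhist :: "(vtx \<Rightarrow> nat) \<Rightarrow> vtx list \<Rightarrow> vtx \<Rightarrow> nat" where
  "Zhist z0 h v = z0 v + length (filter (\<lambda>u. u = v) (tl h))"

definition vrrw_trans :: "nat \<Rightarrow> (nat \<Rightarrow> nat) \<Rightarrow> (vtx \<Rightarrow> nat) \<Rightarrow> vtx list \<Rightarrow> vtx \<Rightarrow> real" where
  "vrrw_trans d r z0 h w =
     (if w \<in> verts d r \<and> adj (last h) w
      then real (Zhist z0 h w) / (\<Sum>y\<in>{y \<in> verts d r. adj (last h) y}. real (Zhist z0 h y))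
      else 0)"

text \<open>X n is X(t0+n). The law of a VRRW started at x0: measurable process with
  X(t0) = x0 a.s. and the prescribed conditional transition probabilities given
  the whole past (stated on cylinder events, which determine the law).\<close>
definition vrrw_law ::
  "'w measure \<Rightarrow> nat \<Rightarrow> (nat \<Rightarrow> nat) \<Rightarrow> (vtx \<Rightarrow> nat) \<Rightarrow> vtx \<Rightarrow> (nat \<Rightarrow> 'w \<Rightarrow> vtx) \<Rightarrow> bool" where
  "vrrw_law M d r z0 x0 X \<longleftrightarrow>
     (\<forall>n. X n \<in> measurable M (count_space UNIV)) \<and>
     (AE \<omega> in M. X 0 \<omega> = x0) \<and>
     (\<forall>n h w. length h = Suc n \<longrightarrow>
        measure M {\<omega> \<in> space M. (\<forall>s\<le>n. X s \<omega> = h ! s) \<and> X (Suc n) \<omega> = w}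
        = measure M {\<omega> \<in> space M. \<forall>s\<le>n. X s \<omega> = h ! s} * vrrw_trans d r z0 h w)"

definition Zcnt :: "(vtx \<Rightarrow> nat) \<Rightarrow> (nat \<Rightarrow> 'w \<Rightarrow> vtx) \<Rightarrow> nat \<Rightarrow> 'w \<Rightarrow> vtx \<Rightarrow> nat" where
  "Zcnt z0 X n \<omega> v = z0 v + card {s \<in> {1..n}. X s \<omega> = v}"

definition occ :: "nat \<Rightarrow> (nat \<Rightarrow> nat) \<Rightarrow> (vtx \<Rightarrow> nat) \<Rightarrow> (nat \<Rightarrow> 'w \<Rightarrow> vtx) \<Rightarrow> nat \<Rightarrow> 'w \<Rightarrow> vtx \<Rightarrow> real" where
  "occ d r z0 X n \<omega> v =
     (if v \<in> verts d r then real (Zcnt z0 X n \<omega> v) / real (tzero d r z0 + n) else 0)"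

definition pi_inf :: "nat \<Rightarrow> (nat \<Rightarrow> nat) \<Rightarrow> (vtx \<Rightarrow> nat) \<Rightarrow> (nat \<Rightarrow> 'w \<Rightarrow> vtx) \<Rightarrow> 'w \<Rightarrow> vtx \<Rightarrow> real" where
  "pi_inf d r z0 X \<omega> =
     (if \<exists>L. \<forall>v. (\<lambda>n. occ d r z0 X n \<omega> v) \<longlonglongrightarrow> L v
      then (THE L. \<forall>v. (\<lambda>n. occ d r z0 X n \<omega> v) \<longlonglongrightarrow> L v)
      else (\<lambda>_. 0))"

definition pi_unif :: "nat \<Rightarrow> vtx \<Rightarrow> real" where
  "pi_unif d v = (case v of Inner i \<Rightarrow> (if 1 \<le> i \<and> i \<le> d then 1 / real d else 0) | Leaf _ _ \<Rightarrow> 0)"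

end

theory Submission
  imports Defs
begin

text \<open>
  Write $Z_i$ for the weight of the interior vertex $i$, $L_i$ for the total weight of its leaves,
  $N_i$ for the total weight of the neighbours of $i$ and $T$ for the total weight. Each visit to a
  vertex raises the logarithm of its weight by about the inverse of the weight, so up to
  square-integrable martingales $\ln Z_i$ equals the sum of $1/N_m$ over the visits to interior
  $m \ne i$ plus the sum of $1/Z_i$ over the visits to the leaves of $i$, and $\ln L_i$ equals the
  sum of $1/N_i$ over the visits to $i$. Boundedness of these martingales is all that is needed.

  As $d \ge 3$, the difference $\ln Z_j - \ln L_i$ with $j \ne i$ is, up to a bounded error, at least
  the sum of $1/N_m$ over the visits to the remaining interior vertices $m$. Hence $L_i \le C Z_j$,
  and $\sum L_i/T^2$ over the visits to any $m \ne i$ is finite. An excursion from $i$ to its leaves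
  has probability $L_i/N_i$, which is bounded away from $1$; this contraction makes $\sum L_i/T^2$
  finite over all times.

  Finally $\sum_i \ln (Z_i/T)$ is bounded above, and by convexity of $1/(1-x)$ its drift is, up to
  summable terms and a bounded potential, at least a multiple of $\sum_i (Z_i/T - 1/d)^2/T$. So this
  series converges, and since the proportions vary by at most $1/T$ per step they tend to $1/d$.
\<close>

section \<open>Real sequences\<close>

text \<open>The estimates \<open>x - x^2 <= ln (1 + x) <= x\<close> at \<open>x = e k / Y k\<close>,
  summed along the steps; the quadratic error is summable since \<open>Y\<close> grows by one
  whenever \<open>e\<close> is one. The denominators carry the weight before the step, as in the
  compensated sums below.\<close>

lemma unit_step_ln_bounds:
  fixes Y e :: "nat \<Rightarrow> real"
  assumes step: "\<And>k. Y (Suc k) = Y k + e k" and e: "\<And>k. e k = 0 \<or> e k = 1" and Y0: "1 \<le> Y 0"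
  shows "1 \<le> Y n"
    and "ln (Y n) \<le> ln (Y 0) + (\<Sum>k<n. e k / Y k)"
    and "(\<Sum>k<n. e k / Y k) \<le> ln (Y n) + 2"
    and "(\<Sum>k<n. e k / (Y k)\<^sup>2) \<le> 2"
proof -
  have ge1: "1 \<le> Y n" for n
    by (induction n) (use Y0 step e in \<open>auto simp: add_increasing2, metis add.right_neutral add_increasing2 zero_le_one\<close>)
  then show "1 \<le> Y n" .
  show "ln (Y n) \<le> ln (Y 0) + (\<Sum>k<n. e k / Y k)"
  proof (induction n)
    case (Suc n)
    have "ln (Y (Suc n)) = ln (Y n * (1 + e n / Y n))"
      using ge1[of n] by (simp add: step distrib_left)
    also have "\<dots> = ln (Y n) + ln (1 + e n / Y n)"
      using ge1[of n] e[of n] by (intro ln_mult_pos) (auto intro!: add_pos_nonneg)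
    also have "ln (1 + e n / Y n) \<le> e n / Y n"
      using ge1[of n] e[of n] by (intro ln_add_one_self_le_self) auto
    finally show ?case using Suc by simp
  qed simp
  \<comment> \<open>For \<open>Y n >= 1\<close> one has
    \<open>1 / Y^2 <= 2 / Y - 2 / (Y + 1)\<close>, so the sum telescopes.\<close>
  have sq: "(\<Sum>k<n. e k / (Y k)\<^sup>2) \<le> 2 / Y 0 - 2 / Y n" for n
  proof (induction n)
    case (Suc n)
    have "e n / (Y n)\<^sup>2 \<le> 2 / Y n - 2 / Y (Suc n)"
    proof (cases "e n = 0")
      case False
      then have [simp]: "e n = 1" using e by blast
      have "(2 / Y n - 2 / Y (Suc n)) - 1 / (Y n)\<^sup>2 = (Y n - 1) / ((Y n)\<^sup>2 * (Y n + 1))"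
      proof -
        have "Y n \<noteq> 0" "Y n + 1 \<noteq> 0" using ge1[of n] by auto
        then show ?thesis by (simp add: step divide_simps power2_eq_square)
      qed
      also have "\<dots> \<ge> 0" using ge1[of n] by simp
      finally show ?thesis by simp
    qed (simp add: step)
    then show ?case using Suc by simp
  qed simp
  have "2 / Y 0 \<le> 2" using Y0 by (simp add: divide_le_eq)
  moreover have "0 \<le> 2 / Y n" for n using ge1[of n] by simp
  ultimately show sq2: "(\<Sum>k<n. e k / (Y k)\<^sup>2) \<le> 2" for n
    using sq[of n] by (smt (verit))
  have "(\<Sum>k<n. e k / Y k) \<le> ln (Y n) - ln (Y 0) + (\<Sum>k<n. e k / (Y k)\<^sup>2)" for n
  proof (induction n)
    case (Suc n)
    have "e n / Y n - (e n / Y n)\<^sup>2 \<le> ln (1 + e n / Y n)"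
      using ge1[of n] e[of n] by (intro ln_one_plus_pos_lower_bound) auto
    also have "\<dots> = ln (Y n * (1 + e n / Y n)) - ln (Y n)"
      using ge1[of n] e[of n] by (subst ln_mult_pos) (auto intro!: add_pos_nonneg)
    also have "Y n * (1 + e n / Y n) = Y (Suc n)"
      using ge1[of n] by (simp add: step distrib_left)
    also have "(e n / Y n)\<^sup>2 = e n / (Y n)\<^sup>2"
      using e[of n] by (auto simp: power_divide)
    finally show ?case using Suc by simp
  qed simp
  from this[of n] sq2[of n] show "(\<Sum>k<n. e k / Y k) \<le> ln (Y n) + 2"
    using Y0 by (smt (verit) ln_ge_zero)
qed

lemma sum_inverse_shift_squares_le:
  fixes T :: "nat \<Rightarrow> real"
  assumes "\<And>k. T (Suc k) = T k + 1" and "1 \<le> T 0"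
  shows "(\<Sum>k<n. 1 / (T k)\<^sup>2) \<le> 2"
  using unit_step_ln_bounds(4)[of T "\<lambda>_. 1" n] assms by simp

text \<open>Discrete version of the integral of \<open>exp (- s)\<close> over the half-line. Steps
  of size at most one cost a factor 2, through \<open>exp (- x) <= 1 - x / 2\<close> on the unit
  interval.\<close>

lemma sum_exp_neg_partial_sums_le:
  fixes b :: "nat \<Rightarrow> real"
  assumes b: "\<And>k. 0 \<le> b k" "\<And>k. b k \<le> 1"
  shows "(\<Sum>k<n. b k * exp (- (\<Sum>j<k. b j))) \<le> 2"
proof -
  have half: "exp (- x) \<le> 1 - x / 2" if "0 \<le> x" "x \<le> 1" for x :: real
  proof -
    have "exp (- x) = 1 / exp x" by (simp add: exp_minus field_simps)
    also have "\<dots> \<le> 1 / (1 + x)"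
      using that exp_ge_add_one_self[of x] by (intro divide_left_mono) auto
    also have "\<dots> \<le> 1 - x / 2"
    proof -
      have "1 \<le> (1 - x / 2) * (1 + x)"
        using that mult_left_mono[of x 1 x] by (simp add: algebra_simps)
      then show ?thesis using that by (simp add: divide_le_eq)
    qed
    finally show ?thesis .
  qed
  have "(\<Sum>k<n. b k * exp (- (\<Sum>j<k. b j))) \<le> 2 - 2 * exp (- (\<Sum>j<n. b j))"
  proof (induction n)
    case (Suc n)
    let ?E = "exp (- (\<Sum>j<n. b j))"
    have "exp (- (\<Sum>j<Suc n. b j)) = ?E * exp (- b n)"
      by (simp add: exp_add[symmetric])
    also have "\<dots> \<le> ?E * (1 - b n / 2)"
      using half b by (intro mult_left_mono) auto
    finally show ?case using Suc by (simp add: algebra_simps)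
  qed simp
  then show ?thesis by (smt (verit) exp_ge_zero)
qed

text \<open>The square of a slowly varying sequence has absolutely summable increments,
  so the sequence converges; divergence of the harmonic series excludes a positive limit.\<close>

lemma slowly_varying_tendsto_zero:
  fixes u T :: "nat \<Rightarrow> real"
  assumes T: "\<And>k. T (Suc k) = T k + 1" "1 \<le> T 0"
    and u: "\<And>k. 0 \<le> u k" and var: "\<And>k. \<bar>u (Suc k) - u k\<bar> \<le> c / T k"
    and bdd: "\<And>n. (\<Sum>k<n. u k / T k) \<le> K"
  shows "u \<longlonglongrightarrow> 0"
proof -
  have Tk: "T k = T 0 + real k" for k by (induction k) (auto simp: T)
  have Tpos: "0 < T k" for k using T(2) Tk[of k] by linarith
  have c: "0 \<le> c" using var[of 0] Tpos[of 0] by (smt (verit) divide_neg_pos)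
  have s1: "summable (\<lambda>k. u k / T k)"
    using bdd u Tpos by (intro summableI_nonneg_bounded[where x = K]) (auto simp: less_imp_le)
  have s2: "summable (\<lambda>k. 1 / (T k)\<^sup>2)"
    using sum_inverse_shift_squares_le[of T] T by (intro summableI_nonneg_bounded[where x = 2]) auto
  have "\<bar>(u (Suc k))\<^sup>2 - (u k)\<^sup>2\<bar> \<le> 2 * c * (u k / T k) + c\<^sup>2 * (1 / (T k)\<^sup>2)" for k
  proof -
    have "\<bar>(u (Suc k))\<^sup>2 - (u k)\<^sup>2\<bar> = \<bar>u (Suc k) - u k\<bar> * (u (Suc k) + u k)"
      using u[of k] u[of "Suc k"]
      by (simp add: power2_eq_square square_diff_square_factored abs_mult mult.commute)
    also have "\<dots> \<le> c / T k * (2 * u k + c / T k)"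
      using var[of k] u[of k] u[of "Suc k"] by (intro mult_mono) (auto simp: abs_if split: if_splits)
    also have "\<dots> = 2 * c * (u k / T k) + c\<^sup>2 * (1 / (T k)\<^sup>2)"
      by (simp add: algebra_simps power2_eq_square)
    finally show ?thesis .
  qed
  then have "summable (\<lambda>k. (u (Suc k))\<^sup>2 - (u k)\<^sup>2)"
    by (intro summable_comparison_test'[OF summable_add[OF summable_mult[OF s1] summable_mult[OF s2]]]) simp
  then have "convergent (\<lambda>n. (\<Sum>k<n. (u (Suc k))\<^sup>2 - (u k)\<^sup>2))"
    by (simp add: summable_iff_convergent)
  then have "convergent (\<lambda>n. (u n)\<^sup>2 - (u 0)\<^sup>2)"
    by (simp add: sum_lessThan_telescope[of "\<lambda>k. (u k)\<^sup>2"])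
  then obtain l where "(\<lambda>n. (u n)\<^sup>2 - (u 0)\<^sup>2) \<longlonglongrightarrow> l"
    by (auto simp: convergent_def)
  then have "(\<lambda>n. ((u n)\<^sup>2 - (u 0)\<^sup>2) + (u 0)\<^sup>2) \<longlonglongrightarrow> l + (u 0)\<^sup>2"
    by (intro tendsto_intros)
  then have "(\<lambda>n. sqrt ((u n)\<^sup>2)) \<longlonglongrightarrow> sqrt (l + (u 0)\<^sup>2)"
    by (intro tendsto_real_sqrt) simp
  then obtain l where l: "u \<longlonglongrightarrow> l" using u by auto
  have "\<not> 0 < l"
  proof
    assume "0 < l"
    then have "eventually (\<lambda>k. l / 2 < u k) sequentially"
      using l by (intro order_tendstoD(1)) auto
    then obtain m where m: "\<And>k. k \<ge> m \<Longrightarrow> l / 2 < u k"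
      by (auto simp: eventually_sequentially)
    have "summable (\<lambda>k. l / 2 / T k)"
    proof (rule summable_comparison_test'[OF s1, of m])
      fix k assume "m \<le> k"
      then show "norm (l / 2 / T k) \<le> u k / T k"
        using m[of k] Tpos[of k] \<open>0 < l\<close> by (simp add: field_simps)
    qed
    then have "summable (\<lambda>k. 2 / l * (l / 2 / T k))" by (rule summable_mult)
    then have sT: "summable (\<lambda>k. 1 / T k)" using \<open>0 < l\<close> by simp
    \<comment> \<open>\<open>T k = T 0 + k\<close> is at most \<open>T 0 * (k + 1)\<close>, so
      \<open>T 0 / T k\<close> dominates the harmonic series.\<close>
    have "summable (\<lambda>k. T 0 * (1 / T k))" using sT by (rule summable_mult)
    then have "summable (\<lambda>k. inverse (real (Suc k)))"
    proof (rule summable_comparison_test')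
      fix k :: nat assume "0 \<le> k"
      have "T k \<le> T 0 * real (Suc k)"
        using T(2) mult_right_mono[of 1 "T 0" "real k"] by (simp add: Tk[of k] algebra_simps)
      then show "norm (inverse (real (Suc k))) \<le> T 0 * (1 / T k)"
        using Tpos[of k] by (simp add: field_simps)
    qed
    then have "summable (\<lambda>k. inverse (real k))" by (subst (asm) summable_Suc_iff)
    then show False using not_summable_harmonic[where 'a = real] by simp
  qed
  moreover have "0 \<le> l" using l u by (intro LIMSEQ_le_const) auto
  ultimately show ?thesis using l by simp
qed

section \<open>Asymptotics along a single path\<close>

text \<open>The path of the walk seen through its indicators: A k i and B k i say that the walk is at
  time k at the interior vertex i, respectively at a leaf attached to i; Z k i and L k i are the
  weight of i and the total weight of its leaves.\<close>

locale walk_path =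
  fixes d :: nat and Z L A B :: "nat \<Rightarrow> nat \<Rightarrow> real"
  assumes d3: "3 \<le> d"
    and A01: "\<And>k i. A k i = 0 \<or> A k i = 1" and B01: "\<And>k i. B k i = 0 \<or> B k i = 1"
    and Z_Suc: "\<And>k i. i \<in> {1..d} \<Longrightarrow> Z (Suc k) i = Z k i + A (Suc k) i"
    and L_Suc: "\<And>k i. i \<in> {1..d} \<Longrightarrow> L (Suc k) i = L k i + B (Suc k) i"
    and Z_0: "\<And>i. i \<in> {1..d} \<Longrightarrow> 1 \<le> Z 0 i"
    and L_0: "\<And>i. i \<in> {1..d} \<Longrightarrow> 1 \<le> L 0 i \<or> (\<forall>k. L k i = 0)"
    and one_place: "\<And>k. (\<Sum>i\<in>{1..d}. A k i + B k i) = 1"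
    and leaf_from: "\<And>k i. i \<in> {1..d} \<Longrightarrow> B (Suc k) i \<le> A k i"
    and inner_from: "\<And>k i. i \<in> {1..d} \<Longrightarrow> A (Suc k) i \<le> B k i + (\<Sum>m\<in>{1..d} - {i}. A k m)"
begin

section \<open>Elementary bounds on weights and normalisers\<close>

definition T :: "nat \<Rightarrow> real" where "T k = (\<Sum>i\<in>{1..d}. Z k i + L k i)"

text \<open>Normaliser of a step out of the interior vertex \<open>i\<close>. A step out of a leaf
  of \<open>i\<close> has normaliser \<open>Z k i\<close>, since \<open>i\<close> is the only
  neighbour of that leaf.\<close>

definition N :: "nat \<Rightarrow> nat \<Rightarrow> real" where "N k i = L k i + (\<Sum>j\<in>{1..d} - {i}. Z k j)"

lemma A_nonneg [simp]: "0 \<le> A k i" and B_nonneg [simp]: "0 \<le> B k i"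
  using A01[of k i] B01[of k i] by auto

lemma Z_ge1: "i \<in> {1..d} \<Longrightarrow> 1 \<le> Z k i"
  by (induction k) (auto simp: Z_0 Z_Suc add_increasing2)

lemma L_nonneg: "i \<in> {1..d} \<Longrightarrow> 0 \<le> L k i"
  using L_0[of i] by (induction k) (force simp: L_Suc)+

lemma T_Suc: "T (Suc k) = T k + 1"
proof -
  have "T (Suc k) = (\<Sum>i\<in>{1..d}. (Z k i + L k i) + (A (Suc k) i + B (Suc k) i))"
    unfolding T_def by (intro sum.cong) (auto simp: Z_Suc L_Suc)
  also have "\<dots> = T k + 1" using one_place[of "Suc k"] by (simp add: sum.distrib T_def)
  finally show ?thesis .
qed

lemma Z_add_L_le_T:
  assumes "i \<in> {1..d}"
  shows "Z k i + L k i \<le> T k"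
proof -
  have "0 \<le> Z k j + L k j" if "j \<in> {1..d}" for j
    using Z_ge1[OF that, of k] L_nonneg[OF that, of k] by linarith
  then show ?thesis
    unfolding T_def using assms by (intro member_le_sum[where f = "\<lambda>i. Z k i + L k i"]) auto
qed

lemma Z_le_T: "i \<in> {1..d} \<Longrightarrow> Z k i \<le> T k"
  using Z_add_L_le_T[of i k] L_nonneg[of i k] by linarith

lemma L_le_T: "i \<in> {1..d} \<Longrightarrow> L k i \<le> T k"
  using Z_add_L_le_T[of i k] Z_ge1[of i k] by linarith

lemma T_ge1: "1 \<le> T k"
  using Z_ge1[of 1 k] Z_le_T[of 1 k] d3 by simp

lemma T_pos [simp]: "0 < T k"
  using T_ge1[of k] by linarith

lemma T_nonneg [simp]: "0 \<le> T k" and T_nonzero [simp]: "T k \<noteq> 0" "1 + T k \<noteq> 0" "T k + 1 \<noteq> 0"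
  using T_ge1[of k] by auto

lemma Z_le_N:
  assumes "i \<in> {1..d}" "j \<in> {1..d}" "i \<noteq> j"
  shows "L k i + Z k j \<le> N k i"
proof -
  have "0 \<le> Z k l" if "l \<in> {1..d}" for l
    using Z_ge1[OF that, of k] by linarith
  then have "Z k j \<le> (\<Sum>l\<in>{1..d} - {i}. Z k l)"
    using assms by (intro member_le_sum) auto
  then show ?thesis by (simp add: N_def)
qed

lemma ex_other_index: "\<exists>j\<in>{1..d}. i \<noteq> j"
  using d3 by (intro bexI[of _ "if i = 1 then 2 else 1"]) auto

lemma N_ge1:
  assumes "i \<in> {1..d}"
  shows "1 \<le> N k i"
proof -
  obtain j where "j \<in> {1..d}" "i \<noteq> j"
    using ex_other_index by blast
  then show ?thesis
    using Z_le_N[of i j k] assms Z_ge1[of j k] L_nonneg[of i k] by linarith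
qed

lemma N_add_Z_le_T:
  assumes "i \<in> {1..d}"
  shows "N k i + Z k i \<le> T k"
proof -
  have "N k i + Z k i = L k i + (\<Sum>j\<in>{1..d}. Z k j)"
    using assms by (simp add: N_def sum.remove[of _ i "Z k"])
  also have "L k i \<le> (\<Sum>j\<in>{1..d}. L k j)"
    using assms L_nonneg by (intro member_le_sum) auto
  finally show ?thesis by (simp add: T_def sum.distrib)
qed

lemma sum_A_le1: "S \<subseteq> {1..d} \<Longrightarrow> (\<Sum>m\<in>S. A k m) \<le> 1"
proof -
  assume "S \<subseteq> {1..d}"
  then have "(\<Sum>m\<in>S. A k m) \<le> (\<Sum>m\<in>{1..d}. A k m)"
    by (intro sum_mono2) auto
  also have "\<dots> \<le> (\<Sum>m\<in>{1..d}. A k m + B k m)"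
    by (intro sum_mono) auto
  finally show ?thesis by (simp only: one_place)
qed

lemma sum_inverse_T_squares: "(\<Sum>k<n. 1 / (T k)\<^sup>2) \<le> 2"
  by (intro sum_inverse_shift_squares_le) (auto simp: T_Suc T_ge1)

end

text \<open>The three boundedness assumptions are the only trace of randomness: the sums are
  martingales of the walk.\<close>

locale typical_path = walk_path +
  assumes inner_mart: "\<And>i. i \<in> {1..d} \<Longrightarrow> \<exists>C. \<forall>n. \<bar>\<Sum>k<n. A (Suc k) i / Z k i
      - ((\<Sum>m\<in>{1..d} - {i}. A k m / N k m) + B k i / Z k i)\<bar> \<le> C"
    and leaf_mart: "\<And>i. i \<in> {1..d} \<Longrightarrow> 1 \<le> L 0 i \<Longrightarrow> \<exists>C. \<forall>n. \<bar>\<Sum>k<n. B (Suc k) i / L k i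
      - A k i / N k i\<bar> \<le> C"
    and leaf_mart_T: "\<And>i. i \<in> {1..d} \<Longrightarrow> \<exists>C. \<forall>n. \<bar>\<Sum>k<n. L k i / (T k)\<^sup>2 *
      (B (Suc k) i - A k i * L k i / N k i)\<bar> \<le> C"
begin

section \<open>Summability of the leaf weights\<close>

text \<open>The compensator in \<open>inner_mart\<close> has a nonnegative part coming from the
  leaves of \<open>i\<close>; dropping it leaves a lower bound for the logarithm.\<close>

lemma ln_Z_ge:
  assumes i: "i \<in> {1..d}"
  shows "\<exists>C. \<forall>n. (\<Sum>k<n. \<Sum>m\<in>{1..d} - {i}. A k m / N k m) - C \<le> ln (Z n i)"
proof -
  from inner_mart[OF i] obtain C where
    C: "\<And>n. \<bar>\<Sum>k<n. A (Suc k) i / Z k i - ((\<Sum>m\<in>{1..d} - {i}. A k m / N k m) + B k i / Z k i)\<bar> \<le> C"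
    by blast
  have "(\<Sum>k<n. \<Sum>m\<in>{1..d} - {i}. A k m / N k m) - (C + 2) \<le> ln (Z n i)" for n
  proof -
    have "0 \<le> (\<Sum>k<n. B k i / Z k i)"
      using Z_ge1[OF i] by (intro sum_nonneg) (auto intro!: divide_nonneg_nonneg intro: order_trans[OF zero_le_one])
    moreover have "(\<Sum>k<n. A (Suc k) i / Z k i) \<le> ln (Z n i) + 2"
      using unit_step_ln_bounds(3)[of "\<lambda>k. Z k i" "\<lambda>k. A (Suc k) i" n] Z_Suc[OF i] A01 Z_0[OF i] by simp
    ultimately show ?thesis using C[of n] by (simp add: sum_subtractf sum.distrib)
  qed
  then show ?thesis by blast
qed

text \<open>Visits to \<open>i\<close> feed \<open>ln L\<close> of \<open>i\<close> and
  \<open>ln Z\<close> of \<open>j\<close> at the same rate \<open>1 / N k i\<close>, so they cancel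
  in the difference. What is left are the visits to third vertices, which only favour
  \<open>Z\<close> of \<open>j\<close>.\<close>

lemma L_over_Z_le:
  assumes i: "i \<in> {1..d}" and j: "j \<in> {1..d}" and ij: "i \<noteq> j"
  shows "\<exists>C>0. \<forall>n. L n i / Z n j \<le> C * exp (- (\<Sum>k<n. \<Sum>m\<in>{1..d} - {i, j}. A k m / N k m))"
proof (cases "1 \<le> L 0 i")
  case False
  then have "L n i = 0" for n using L_0[OF i] by auto
  then show ?thesis by (intro exI[of _ 1]) simp
next
  case True
  from ln_Z_ge[OF j] obtain C1 where
    C1: "\<And>n. (\<Sum>k<n. \<Sum>m\<in>{1..d} - {j}. A k m / N k m) - C1 \<le> ln (Z n j)" by blast
  from leaf_mart[OF i True] obtain C2 where
    C2: "\<And>n. \<bar>\<Sum>k<n. B (Suc k) i / L k i - A k i / N k i\<bar> \<le> C2" by blast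
  let ?E = "\<lambda>n. \<Sum>k<n. \<Sum>m\<in>{1..d} - {i, j}. A k m / N k m"
  have "L n i / Z n j \<le> exp (ln (L 0 i) + C1 + C2) * exp (- ?E n)" for n
  proof -
    have Lb: "1 \<le> L n i" "ln (L n i) \<le> ln (L 0 i) + (\<Sum>k<n. B (Suc k) i / L k i)"
      using unit_step_ln_bounds(1,2)[of "\<lambda>k. L k i" "\<lambda>k. B (Suc k) i" n] L_Suc[OF i] B01 True by auto
    have eq: "{1..d} - {j} = insert i ({1..d} - {i, j})" using i ij by auto
    have "(\<Sum>m\<in>{1..d} - {j}. A k m / N k m)
        = A k i / N k i + (\<Sum>m\<in>{1..d} - {i, j}. A k m / N k m)" for k
      by (subst eq, subst sum.insert) auto
    then have "(\<Sum>k<n. A k i / N k i) + ?E n - C1 \<le> ln (Z n j)"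
      using C1[of n] by (simp add: sum.distrib)
    then have "ln (L n i) - ln (Z n j) \<le> ln (L 0 i) + C1 + C2 - ?E n"
      using Lb(2) C2[of n] by (simp add: sum_subtractf)
    then have "exp (ln (L n i) - ln (Z n j)) \<le> exp (ln (L 0 i) + C1 + C2 - ?E n)" by simp
    then show ?thesis using Lb(1) Z_ge1[OF j, of n] by (simp add: exp_diff exp_minus divide_inverse)
  qed
  then show ?thesis by (intro exI[of _ "exp (ln (L 0 i) + C1 + C2)"]) auto
qed

text \<open>As \<open>d >= 3\<close> there is a \<open>j\<close> other than \<open>i\<close> and
  \<open>m\<close>. Each visit to \<open>m\<close> then enlarges the exponent in
  \<open>L_over_Z_le\<close> by \<open>1 / N k m\<close>, and
  \<open>sum_exp_neg_partial_sums_le\<close> applies.\<close>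

lemma other_visits_summable:
  assumes i: "i \<in> {1..d}" and m: "m \<in> {1..d}" and im: "i \<noteq> m"
  shows "\<exists>C. \<forall>n. (\<Sum>k<n. A k m * (L k i / (T k)\<^sup>2)) \<le> C"
proof -
  have "\<not> {1..d} \<subseteq> {i, m}"
  proof
    assume "{1..d} \<subseteq> {i, m}"
    then have "card {1..d} \<le> card {i, m}" by (intro card_mono) auto
    also have "\<dots> \<le> 2" by (simp add: card_insert_if)
    finally show False using d3 by simp
  qed
  then obtain j where j: "j \<in> {1..d}" "j \<noteq> i" "j \<noteq> m" by blast
  let ?b = "\<lambda>k. \<Sum>l\<in>{1..d} - {i, j}. A k l / N k l"
  obtain C where C: "C > 0" "\<And>n. L n i / Z n j \<le> C * exp (- (\<Sum>k<n. ?b k))"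
    using L_over_Z_le[OF i j(1)] j(2) by blast
  have N1: "1 \<le> N k l" if "l \<in> {1..d}" for k l using N_ge1 that .
  have b0: "0 \<le> ?b k" for k
    using N1 by (intro sum_nonneg divide_nonneg_nonneg) (auto intro: order_trans[OF zero_le_one])
  have b1: "?b k \<le> 1" for k
  proof -
    have "A k l / N k l \<le> A k l" if "l \<in> {1..d}" for l
      using divide_left_mono[of 1 "N k l" "A k l"] N1[OF that, of k] by simp
    then have "?b k \<le> (\<Sum>l\<in>{1..d} - {i, j}. A k l)"
      by (intro sum_mono) blast
    also have "\<dots> \<le> 1" by (intro sum_A_le1) auto
    finally show ?thesis .
  qed
  \<comment> \<open>One factor \<open>T k\<close> is bounded below by \<open>Z k j\<close>, the
    other by \<open>N k m\<close>, which turns the visit to \<open>m\<close> into a part of the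
    increment \<open>?b k\<close>.\<close>
  have "A k m * (L k i / (T k)\<^sup>2) \<le> C * (?b k * exp (- (\<Sum>k<k. ?b k)))" for k
  proof -
    have "Z k j * N k m \<le> T k * T k"
      using Z_le_T[OF j(1), of k] N_add_Z_le_T[OF m, of k] Z_ge1[OF m, of k] Z_ge1[OF j(1), of k] N1[OF m, of k]
      by (intro mult_mono) auto
    then have "L k i / (T k)\<^sup>2 \<le> L k i / (Z k j * N k m)"
      unfolding power2_eq_square using L_nonneg[OF i, of k] Z_ge1[OF j(1), of k] N1[OF m, of k]
      by (intro divide_left_mono) auto
    then have "A k m * (L k i / (T k)\<^sup>2) \<le> A k m * (L k i / (Z k j * N k m))"
      by (intro mult_left_mono) auto
    also have "\<dots> = A k m / N k m * (L k i / Z k j)" by simp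
    also have "\<dots> \<le> ?b k * (L k i / Z k j)"
    proof (rule mult_right_mono)
      show "A k m / N k m \<le> ?b k"
        using N1 m im j by (intro member_le_sum[where f = "\<lambda>l. A k l / N k l"])
          (auto intro!: divide_nonneg_nonneg intro: order_trans[OF zero_le_one])
      show "0 \<le> L k i / Z k j" using L_nonneg[OF i, of k] Z_ge1[OF j(1), of k] by simp
    qed
    also have "\<dots> \<le> ?b k * (C * exp (- (\<Sum>k<k. ?b k)))"
      using C(2) b0 by (intro mult_left_mono)
    finally show ?thesis by (simp add: mult_ac)
  qed
  then have "(\<Sum>k<n. A k m * (L k i / (T k)\<^sup>2)) \<le> (\<Sum>k<n. C * (?b k * exp (- (\<Sum>k<k. ?b k))))" for n
    by (intro sum_mono)
  also have "(\<Sum>k<n. C * (?b k * exp (- (\<Sum>k<k. ?b k)))) \<le> C * 2" for n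
    using sum_exp_neg_partial_sums_le[of ?b n] b0 b1 C(1)
    unfolding sum_distrib_left[symmetric] by (intro mult_left_mono) auto
  finally show ?thesis by blast
qed

text \<open>Time is split by the position of the walk. Visits to other interior vertices are covered
  by \<open>other_visits_summable\<close>. Visits to \<open>i\<close> (\<open>V\<close>) and
  excursions from \<open>i\<close> to its leaves (\<open>W\<close>) bound each other,
  \<open>V <= W + const\<close> and \<open>W <= q V + const\<close> with \<open>q < 1\<close>, so
  both are bounded. Times spent at leaves follow interior visits.\<close>

lemma sum_L_over_T_squared:
  assumes i: "i \<in> {1..d}"
  shows "\<exists>C. \<forall>n. (\<Sum>k<n. L k i / (T k)\<^sup>2) \<le> C"
proof -
  define w where "w k = L k i / (T k)\<^sup>2" for k
  have w0: "0 \<le> w k" for k using L_nonneg[OF i] by (simp add: w_def)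
  have w_le1: "w k \<le> 1" for k
  proof -
    have "L k i * 1 \<le> T k * T k"
      using L_le_T[OF i, of k] T_ge1[of k] L_nonneg[OF i, of k] by (intro mult_mono) auto
    then show ?thesis by (simp add: w_def power2_eq_square)
  qed
  have w_Suc: "w (Suc k) \<le> w k + 1 / (T k)\<^sup>2" for k
  proof -
    have "w (Suc k) \<le> (L k i + 1) / (T k)\<^sup>2"
      unfolding w_def using L_nonneg[OF i, of k] B01[of "Suc k" i] T_ge1[of k]
      by (intro frac_le) (auto simp: T_Suc L_Suc[OF i] intro!: power_mono)
    then show ?thesis by (simp add: w_def add_divide_distrib)
  qed
  \<comment> \<open>Moving an indicator by one time unit against the slowly varying weight
    \<open>w\<close> costs at most 3: 1 for the term at time 0 and 2 for the sum of
    \<open>1 / T^2\<close>.\<close>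
  have shift: "(\<Sum>k<n. a k * w k) \<le> 3 + (\<Sum>k<n. a (Suc k) * w k)" if a: "\<And>k. a k = 0 \<or> a k = 1" for a n
  proof -
    have a01: "0 \<le> a k" "a k \<le> 1" for k using a[of k] by auto
    have "(\<Sum>k<n. a k * w k) \<le> (\<Sum>k<Suc n. a k * w k)" using a01 w0 by simp
    moreover have "(\<Sum>k<Suc n. a k * w k) = a 0 * w 0 + (\<Sum>k<n. a (Suc k) * w (Suc k))"
      by (rule sum.lessThan_Suc_shift)
    moreover have "a 0 * w 0 \<le> 1 * 1" using a01 w0 w_le1 by (intro mult_mono) auto
    moreover have "(\<Sum>k<n. a (Suc k) * w (Suc k)) \<le> (\<Sum>k<n. a (Suc k) * w k + 1 / (T k)\<^sup>2)"
    proof (rule sum_mono)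
      fix k
      have "a (Suc k) * w (Suc k) \<le> a (Suc k) * (w k + 1 / (T k)\<^sup>2)"
        using a01 w_Suc by (intro mult_left_mono)
      also have "\<dots> \<le> a (Suc k) * w k + 1 / (T k)\<^sup>2"
        using a[of "Suc k"] by auto
      finally show "a (Suc k) * w (Suc k) \<le> a (Suc k) * w k + 1 / (T k)\<^sup>2" .
    qed
    moreover have "\<dots> \<le> (\<Sum>k<n. a (Suc k) * w k) + 2"
      using sum_inverse_T_squares[of n] by (simp add: sum.distrib)
    ultimately show ?thesis by linarith
  qed
  define V where "V n = (\<Sum>k<n. A k i * w k)" for n
  define W where "W n = (\<Sum>k<n. B (Suc k) i * w k)" for n
  have "\<forall>m\<in>{1..d} - {i}. \<exists>C. \<forall>n. (\<Sum>k<n. A k m * w k) \<le> C"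
    unfolding w_def using other_visits_summable[OF i] by blast
  then obtain c where c: "\<And>m n. m \<in> {1..d} - {i} \<Longrightarrow> (\<Sum>k<n. A k m * w k) \<le> c m"
    by metis
  define c' where "c' = (\<Sum>m\<in>{1..d} - {i}. c m)"
  have others: "(\<Sum>k<n. (\<Sum>m\<in>{1..d} - {i}. A k m) * w k) \<le> c'" for n
  proof -
    have "(\<Sum>k<n. (\<Sum>m\<in>{1..d} - {i}. A k m) * w k) = (\<Sum>m\<in>{1..d} - {i}. \<Sum>k<n. A k m * w k)"
      unfolding sum_distrib_right by (rule sum.swap)
    also have "\<dots> \<le> c'" unfolding c'_def using c by (intro sum_mono) auto
    finally show ?thesis .
  qed
  \<comment> \<open>The walk reaches \<open>i\<close> from a leaf of \<open>i\<close> or from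
    another interior vertex. The shift is used twice, for \<open>A\<close> and then for
    \<open>B\<close>, whence \<open>6 = 3 + 3\<close>.\<close>
  have V_le: "V n \<le> 6 + W n + c'" for n
  proof -
    have "V n \<le> 3 + (\<Sum>k<n. A (Suc k) i * w k)"
      unfolding V_def by (rule shift) (rule A01)
    moreover have "(\<Sum>k<n. A (Suc k) i * w k) \<le> (\<Sum>k<n. B k i * w k + (\<Sum>m\<in>{1..d} - {i}. A k m) * w k)"
      unfolding distrib_right[symmetric] by (intro sum_mono mult_right_mono inner_from i w0)
    moreover have "(\<Sum>k<n. B k i * w k) \<le> 3 + W n"
      unfolding W_def by (rule shift) (rule B01)
    ultimately show ?thesis using others[of n] unfolding sum.distrib by linarith
  qed
  obtain C where C: "\<And>n. \<bar>\<Sum>k<n. w k * (B (Suc k) i - A k i * L k i / N k i)\<bar> \<le> C"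
    unfolding w_def using leaf_mart_T[OF i] by blast
  \<comment> \<open>From \<open>L k i <= E * Z k j\<close> and \<open>L k i + Z k j <= N k i\<close>
    the escape probability to the leaves is at most \<open>E / (1 + E)\<close>, uniformly in
    time.\<close>
  obtain q where q: "0 < q" "q < 1" "\<And>k. L k i / N k i \<le> q"
  proof -
    obtain j where j: "j \<in> {1..d}" "i \<noteq> j"
      using ex_other_index by blast
    obtain E where E: "E > 0" "\<And>n. L n i / Z n j \<le> E * exp (- (\<Sum>k<n. \<Sum>m\<in>{1..d} - {i, j}. A k m / N k m))"
      using L_over_Z_le[OF i j] by blast
    have "L k i / N k i \<le> E / (1 + E)" for k
    proof -
      have "0 \<le> (\<Sum>k<k. \<Sum>m\<in>{1..d} - {i, j}. A k m / N k m)"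
        using N_ge1 by (intro sum_nonneg divide_nonneg_nonneg) (auto intro: order_trans[OF zero_le_one])
      then have "E * exp (- (\<Sum>k<k. \<Sum>m\<in>{1..d} - {i, j}. A k m / N k m)) \<le> E * 1"
        using E(1) by (intro mult_left_mono) auto
      then have "L k i / Z k j \<le> E" using E(2)[of k] by linarith
      then have LZ: "L k i \<le> E * Z k j" using Z_ge1[OF j(1), of k] by (simp add: divide_le_eq)
      have "L k i * (1 + E) = L k i + E * L k i" by (simp add: algebra_simps)
      also have "\<dots> \<le> E * (L k i + Z k j)" using LZ by (simp add: algebra_simps)
      also have "\<dots> \<le> E * N k i" using Z_le_N[OF i j, of k] E(1) by (intro mult_left_mono) auto
      finally show ?thesis using N_ge1[OF i, of k] E(1) by (simp add: field_simps)
    qed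
    moreover have "0 < E / (1 + E)" "E / (1 + E) < 1" using E(1) by auto
    ultimately show ?thesis using that by blast
  qed
  have W_le: "W n \<le> C + q * V n" for n
  proof -
    have "W n - (\<Sum>k<n. w k * (A k i * L k i / N k i)) \<le> C"
      using C[of n] by (simp add: W_def algebra_simps sum_subtractf)
    moreover have "(\<Sum>k<n. w k * (A k i * L k i / N k i)) \<le> (\<Sum>k<n. q * (A k i * w k))"
    proof (rule sum_mono)
      fix k
      have "(w k * A k i) * (L k i / N k i) \<le> (w k * A k i) * q"
        using w0 q(3) by (intro mult_left_mono) auto
      then show "w k * (A k i * L k i / N k i) \<le> q * (A k i * w k)" by (simp add: mult_ac)
    qed
    ultimately show ?thesis by (simp add: V_def sum_distrib_left)
  qed
  define K where "K = (6 + C + c') / (1 - q)"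
  have V_bdd: "V n \<le> K" for n
  proof -
    have "V n * (1 - q) \<le> 6 + C + c'" using V_le[of n] W_le[of n] by (simp add: algebra_simps)
    then show ?thesis using q by (simp add: K_def le_divide_eq)
  qed
  have "(\<Sum>k<n. w k) \<le> (3 + (c' + K)) + (c' + K)" for n
  proof -
    have A_sum: "(\<Sum>k<n. (\<Sum>m\<in>{1..d}. A k m) * w k) \<le> c' + K" for n
    proof -
      have "(\<Sum>m\<in>{1..d}. A k m) = (\<Sum>m\<in>{1..d} - {i}. A k m) + A k i" for k
        using i by (simp add: sum.remove[of _ i])
      then show ?thesis using others[of n] V_bdd[of n] by (simp add: distrib_right sum.distrib V_def)
    qed
    \<comment> \<open>The walk is at one place at a time, so the total leaf indicator is again 0 or
      1 and \<open>shift\<close> applies to it.\<close>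
    have B01': "(\<Sum>m\<in>{1..d}. B k m) = 0 \<or> (\<Sum>m\<in>{1..d}. B k m) = 1" for k
    proof (cases "\<exists>m\<in>{1..d}. B k m = 1")
      case True
      then obtain m where m: "m \<in> {1..d}" "B k m = 1" by blast
      have "B k m \<le> (\<Sum>m\<in>{1..d}. B k m)" using m by (intro member_le_sum) auto
      moreover have "(\<Sum>m\<in>{1..d}. B k m) \<le> (\<Sum>m\<in>{1..d}. A k m + B k m)" by (intro sum_mono) simp
      ultimately show ?thesis using m one_place[of k] by linarith
    next
      case False
      then show ?thesis using B01 by (intro disjI1 sum.neutral) blast
    qed
    have "(\<Sum>k<n. w k) = (\<Sum>k<n. (\<Sum>m\<in>{1..d}. B k m) * w k) + (\<Sum>k<n. (\<Sum>m\<in>{1..d}. A k m) * w k)"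
    proof -
      have "(\<Sum>m\<in>{1..d}. B k m) * w k + (\<Sum>m\<in>{1..d}. A k m) * w k = w k" for k
      proof -
        have "(\<Sum>m\<in>{1..d}. B k m) + (\<Sum>m\<in>{1..d}. A k m) = 1"
          using one_place[of k] unfolding sum.distrib by linarith
        then show ?thesis unfolding distrib_right[symmetric] by (simp only: mult_1)
      qed
      then show ?thesis unfolding sum.distrib[symmetric] by (intro sum.cong) auto
    qed
    moreover have "(\<Sum>k<n. (\<Sum>m\<in>{1..d}. B k m) * w k) \<le> 3 + (\<Sum>k<n. (\<Sum>m\<in>{1..d}. B (Suc k) m) * w k)"
      by (rule shift) (rule B01')
    \<comment> \<open>Every step onto a leaf starts at the interior vertex that carries it.\<close>
    moreover have "(\<Sum>k<n. (\<Sum>m\<in>{1..d}. B (Suc k) m) * w k) \<le> (\<Sum>k<n. (\<Sum>m\<in>{1..d}. A k m) * w k)"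
      by (intro sum_mono mult_right_mono leaf_from w0)
    ultimately show ?thesis using A_sum[of n] by linarith
  qed
  then show ?thesis unfolding w_def by blast
qed

lemma sum_all_leaves_over_T_squared:
  "\<exists>C. \<forall>n. (\<Sum>k<n. (\<Sum>i\<in>{1..d}. L k i) / (T k)\<^sup>2) \<le> C"
proof -
  obtain c where c: "\<And>i n. i \<in> {1..d} \<Longrightarrow> (\<Sum>k<n. L k i / (T k)\<^sup>2) \<le> c i"
    using sum_L_over_T_squared by metis
  have "(\<Sum>k<n. (\<Sum>i\<in>{1..d}. L k i) / (T k)\<^sup>2) \<le> (\<Sum>i\<in>{1..d}. c i)" for n
    unfolding sum_divide_distrib by (subst sum.swap) (intro sum_mono c)
  then show ?thesis by blast
qed

section \<open>Summability of the deviation from uniform proportions\<close>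

text \<open>Summation by parts: leaf visits are the increments of the total leaf weight, and the
  decrease of \<open>1 / T\<close> is at most \<open>1 / T^2\<close>. Consequently interior visits
  weighted by \<open>1 / T\<close> differ from the harmonic sum by a bounded amount.\<close>

lemma sum_leaf_visits_over_T: "\<exists>C. \<forall>n. (\<Sum>k<n. (\<Sum>i\<in>{1..d}. B k i) / T k) \<le> C"
proof -
  define \<Lambda> where "\<Lambda> k = (\<Sum>i\<in>{1..d}. L k i)" for k
  define \<beta> where "\<beta> k = (\<Sum>i\<in>{1..d}. B k i)" for k
  obtain C where C: "\<And>n. (\<Sum>k<n. \<Lambda> k / (T k)\<^sup>2) \<le> C"
    using sum_all_leaves_over_T_squared unfolding \<Lambda>_def by blast
  have \<beta>0: "0 \<le> \<beta> k" for k unfolding \<beta>_def by (intro sum_nonneg) simp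
  have \<Lambda>0: "0 \<le> \<Lambda> k" for k unfolding \<Lambda>_def by (intro sum_nonneg L_nonneg)
  have \<Lambda>_Suc: "\<Lambda> (Suc k) = \<Lambda> k + \<beta> (Suc k)" for k
    unfolding \<Lambda>_def \<beta>_def sum.distrib[symmetric] by (intro sum.cong) (auto simp: L_Suc)
  have \<Lambda>_le: "\<Lambda> k \<le> T k" for k
    unfolding \<Lambda>_def T_def using Z_ge1[of _ k] by (intro sum_mono) (smt (verit))
  have \<beta>1: "\<beta> k \<le> 1" for k
  proof -
    have "\<beta> k \<le> (\<Sum>i\<in>{1..d}. A k i + B k i)" unfolding \<beta>_def by (intro sum_mono) simp
    then show ?thesis by (simp only: one_place)
  qed
  \<comment> \<open>The visit at time 0 is not an increment of the leaf weight; it is absorbed by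
    the leading 1.\<close>
  have "(\<Sum>k<Suc n. \<beta> k / T k) \<le> 1 + \<Lambda> n / T n + (\<Sum>k<n. \<Lambda> k / (T k)\<^sup>2)" for n
  proof (induction n)
    case 0
    have "\<beta> 0 / T 0 \<le> 1" using \<beta>1[of 0] T_ge1[of 0] by (simp add: divide_le_eq)
    moreover have "0 \<le> \<Lambda> 0 / T 0" using \<Lambda>0[of 0] T_pos[of 0] by simp
    ultimately have "\<beta> 0 / T 0 \<le> 1 + \<Lambda> 0 / T 0" by linarith
    then show ?case by simp
  next
    case (Suc n)
    have "1 / T n - 1 / (T n + 1) \<le> 1 / (T n)\<^sup>2"
    proof -
      have "1 / T n - 1 / (T n + 1) = 1 / (T n * (T n + 1))"
        using T_pos[of n] by (simp add: divide_simps)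
      also have "\<dots> \<le> 1 / (T n * T n)"
        using T_pos[of n] by (intro divide_left_mono mult_left_mono mult_pos_pos) (auto intro: add_pos_pos)
      finally show ?thesis by (simp add: power2_eq_square)
    qed
    then have "\<Lambda> n * (1 / T n - 1 / (T n + 1)) \<le> \<Lambda> n * (1 / (T n)\<^sup>2)"
      using \<Lambda>0 by (intro mult_left_mono)
    then have "\<beta> (Suc n) / T (Suc n) \<le> \<Lambda> (Suc n) / T (Suc n) - \<Lambda> n / T n + \<Lambda> n / (T n)\<^sup>2"
      by (simp add: \<Lambda>_Suc T_Suc add_divide_distrib algebra_simps)
    then show ?case using Suc by simp
  qed
  moreover have "\<Lambda> n / T n \<le> 1" for n using \<Lambda>_le[of n] T_pos[of n] by (simp add: divide_le_eq)
  ultimately have le: "(\<Sum>k<Suc n. \<beta> k / T k) \<le> 2 + C" for n using C[of n] by (smt (verit))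
  have "(\<Sum>k<n. \<beta> k / T k) \<le> 2 + C" for n
  proof -
    have "0 \<le> \<beta> n / T n" using \<beta>0[of n] T_pos[of n] by simp
    then show ?thesis using le[of n] by simp
  qed
  then show ?thesis unfolding \<beta>_def by blast
qed

text \<open>Discrete form of integrating d(Q / (2 T^2)) by parts, where Q is the sum of the squared
  interior weights.\<close>

lemma energy_le_visits:
  "(\<Sum>k<n. (\<Sum>i\<in>{1..d}. (Z k i / T k)\<^sup>2) / T k) \<le>
   (\<Sum>k<Suc n. \<Sum>i\<in>{1..d}. A k i * Z k i / (T k)\<^sup>2) + 5"
proof -
  define Q where "Q k = (\<Sum>i\<in>{1..d}. (Z k i)\<^sup>2)" for k
  define P where "P k = (\<Sum>i\<in>{1..d}. A k i * Z k i / (T k)\<^sup>2)" for k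
  have Q0: "0 \<le> Q k" for k unfolding Q_def by (intro sum_nonneg) simp
  have Q_le: "Q k \<le> (T k)\<^sup>2" for k
  proof -
    have "Q k \<le> (\<Sum>i\<in>{1..d}. T k * Z k i)"
      unfolding Q_def power2_eq_square using Z_le_T[of _ k] Z_ge1[of _ k]
      by (intro sum_mono mult_right_mono) (auto intro: order_trans[OF zero_le_one])
    also have "\<dots> = T k * (\<Sum>i\<in>{1..d}. Z k i)" by (simp add: sum_distrib_left)
    also have "\<dots> \<le> T k * T k"
    proof (intro mult_left_mono)
      show "(\<Sum>i\<in>{1..d}. Z k i) \<le> T k" unfolding T_def using L_nonneg[of _ k] by (intro sum_mono) simp
    qed (simp add: less_imp_le)
    finally show ?thesis by (simp add: power2_eq_square)
  qed
  have P0: "0 \<le> P k" for k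
    unfolding P_def using Z_ge1[of _ k]
    by (intro sum_nonneg divide_nonneg_nonneg mult_nonneg_nonneg) (auto intro: order_trans[OF zero_le_one])
  have P_Suc: "Q (Suc k) / (T (Suc k))\<^sup>2 / 2 - Q k / (T k)\<^sup>2 / 2 + Q k / (T k)\<^sup>2 / T k - 2 / (T k)\<^sup>2 \<le> P (Suc k)" for k
  proof -
    have "Q (Suc k) - Q k \<le> (\<Sum>i\<in>{1..d}. 2 * (A (Suc k) i * Z (Suc k) i))"
      unfolding Q_def sum_subtractf[symmetric]
    proof (rule sum_mono)
      fix i assume i: "i \<in> {1..d}"
      \<comment> \<open>For \<open>A = 1\<close> this reads
        \<open>2 Z + 1 <= 2 (Z + 1)\<close>.\<close>
      show "(Z (Suc k) i)\<^sup>2 - (Z k i)\<^sup>2 \<le> 2 * (A (Suc k) i * Z (Suc k) i)"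
        using A01[of "Suc k" i] by (auto simp: Z_Suc[OF i] power2_eq_square algebra_simps)
    qed
    also have "\<dots> = 2 * (T (Suc k))\<^sup>2 * P (Suc k)"
      unfolding P_def sum_distrib_left by (intro sum.cong) auto
    finally have 1: "(Q (Suc k) - Q k) / (T (Suc k))\<^sup>2 / 2 \<le> P (Suc k)"
      using T_pos[of "Suc k"] by (simp add: divide_le_eq mult_ac)
    define t where "t = T k"
    have t: "1 \<le> t" "T (Suc k) = t + 1" using T_ge1[of k] by (auto simp: t_def T_Suc)
    \<comment> \<open>The drop of \<open>1 / t^2\<close> in one step is its derivative
      \<open>2 / t^3\<close> up to \<open>4 / t^4\<close>; multiplied by \<open>Q k <= t^2\<close>
      this error becomes summable.\<close>
    have "2 / t ^ 3 - (1 / t\<^sup>2 - 1 / (t + 1)\<^sup>2) = (3 * t + 2) / (t ^ 3 * (t + 1)\<^sup>2)"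
      using t(1) by (simp add: divide_simps) (simp add: algebra_simps eval_nat_numeral)
    also have "\<dots> \<le> 4 / t ^ 4"
    proof -
      have "(3 * t + 2) * t ^ 4 \<le> 4 * (t ^ 3 * (t + 1)\<^sup>2)"
      proof -
        have "4 * (t ^ 3 * (t + 1)\<^sup>2) - (3 * t + 2) * t ^ 4 = t ^ 3 * (t\<^sup>2 + 6 * t + 4)"
          by (simp add: algebra_simps power2_eq_square power3_eq_cube power4_eq_xxxx)
        also have "\<dots> \<ge> 0" using t(1) by simp
        finally show ?thesis by simp
      qed
      then show ?thesis using t(1) by (simp add: divide_simps)
    qed
    finally have "Q k * (2 / t ^ 3 - 4 / t ^ 4) \<le> Q k * (1 / t\<^sup>2 - 1 / (t + 1)\<^sup>2)"
      using Q0[of k] by (intro mult_left_mono) linarith+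
    moreover have "Q k * (4 / t ^ 4) \<le> 4 / t\<^sup>2"
    proof -
      have "Q k * (4 / t ^ 4) \<le> t\<^sup>2 * (4 / t ^ 4)"
        using Q_le[of k] t(1) by (intro mult_right_mono) (auto simp: t_def)
      then show ?thesis using t(1) by (simp add: divide_simps power2_eq_square power4_eq_xxxx)
    qed
    ultimately have "Q k * (2 / t ^ 3) - 4 / t\<^sup>2 \<le> Q k / t\<^sup>2 - Q k / (t + 1)\<^sup>2"
      by (simp add: algebra_simps)
    moreover have "Q k * (2 / t ^ 3) = 2 * (Q k / t\<^sup>2 / t)"
      by (simp add: power2_eq_square power3_eq_cube mult_ac)
    ultimately have "2 * (Q k / t\<^sup>2 / t) - 4 / t\<^sup>2 \<le> Q k / t\<^sup>2 - Q k / (t + 1)\<^sup>2"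
      by simp
    moreover have "x / 2 - w / 2 + z - 2 / v \<le> p"
      if "(x - y) / 2 \<le> p" "2 * z - 4 / v \<le> w - y" for x y z w v p :: real
      using that by (simp add: field_simps)
    ultimately show ?thesis
      using 1 unfolding t(2) t_def[symmetric] diff_divide_distrib[of _ _ "(t + 1)\<^sup>2"] by blast
  qed
  have tele: "(\<Sum>k<n. Q k / (T k)\<^sup>2 / T k) \<le> (\<Sum>k<n. P (Suc k)) - (Q n / (T n)\<^sup>2 - Q 0 / (T 0)\<^sup>2) / 2 + 2 * (\<Sum>k<n. 1 / (T k)\<^sup>2)" for n
  proof (induction n)
    case (Suc n)
    have [simp]: "2 * (x + 1 / (T n)\<^sup>2) = 2 * x + 2 / (T n)\<^sup>2" for x by simp
    show ?case using Suc P_Suc[of n] by (simp add: diff_divide_distrib)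
  qed simp
  \<comment> \<open>The 5 leaves room for \<open>2 * 2\<close> from the inverse squares and
    \<open>1 / 2\<close> from the initial quotient.\<close>
  have "(\<Sum>k<n. Q k / (T k)\<^sup>2 / T k) \<le> (\<Sum>k<n. P (Suc k)) + 5"
  proof -
    have "0 \<le> Q n / (T n)\<^sup>2" using Q0 by simp
    moreover have "Q 0 / (T 0)\<^sup>2 \<le> 1" using Q_le[of 0] T_pos[of 0] by (simp add: divide_le_eq)
    ultimately show ?thesis
      using tele[of n] sum_inverse_T_squares[of n] by argo
  qed
  moreover have "(\<Sum>k<Suc n. P k) = P 0 + (\<Sum>k<n. P (Suc k))"
    by (rule sum.lessThan_Suc_shift)
  moreover have "(\<Sum>i\<in>{1..d}. (Z k i / T k)\<^sup>2) = Q k / (T k)\<^sup>2" for k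
    by (simp add: Q_def power_divide sum_divide_distrib)
  ultimately show ?thesis using P0[of 0] by (simp add: P_def)
qed

text \<open>The Lyapunov function is the sum of the logarithms of the interior proportions. It is bounded
  above, and the tangent of 1 / (1 - x) at x = 1 / d bounds its drift from below.\<close>

lemma sum_square_deviation_over_T:
  "\<exists>C. \<forall>n. (\<Sum>k<n. (\<Sum>i\<in>{1..d}. (Z k i / T k - 1 / real d)\<^sup>2) / T k) \<le> C"
proof -
  define D where "D = real d"
  have D: "3 \<le> D" using d3 by (simp add: D_def)
  \<comment> \<open>Slope at \<open>x = 1 / D\<close> of \<open>(D - 1) / (1 - x)\<close>. The value
    there is \<open>D\<close>, so by \<open>\<kappa> - D = \<kappa> / D\<close> the tangent is
    \<open>(2 * D - \<kappa>) + \<kappa> * x\<close>.\<close>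
  define \<kappa> where "\<kappa> = D\<^sup>2 / (D - 1)"
  define H where "H n = (\<Sum>k<n. 1 / T k)" for n
  define P where "P k = (\<Sum>i\<in>{1..d}. A k i * Z k i / (T k)\<^sup>2)" for k
  define \<Lambda> where "\<Lambda> k = (\<Sum>i\<in>{1..d}. L k i)" for k
  obtain cL where cL: "\<And>n. (\<Sum>k<n. \<Lambda> k / (T k)\<^sup>2) \<le> cL"
    using sum_all_leaves_over_T_squared unfolding \<Lambda>_def by blast
  obtain cB where cB: "\<And>n. (\<Sum>k<n. (\<Sum>i\<in>{1..d}. B k i) / T k) \<le> cB"
    using sum_leaf_visits_over_T by blast
  obtain c where c: "\<And>i n. i \<in> {1..d} \<Longrightarrow> (\<Sum>k<n. \<Sum>m\<in>{1..d} - {i}. A k m / N k m) - c i \<le> ln (Z n i)"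
    using ln_Z_ge by metis
  define c' where "c' = (\<Sum>i\<in>{1..d}. c i)"
  have \<kappa>: "\<kappa> \<le> 2 * D" "0 < \<kappa>" "\<kappa> - D = \<kappa> / D"
    using D by (simp_all add: \<kappa>_def divide_simps power2_eq_square) (simp_all add: algebra_simps)
  have tangent: "(2 * D - \<kappa>) * (A k m / T k) + \<kappa> * (A k m * Z k m / (T k)\<^sup>2) \<le> (D - 1) * (A k m / N k m)"
    if m: "m \<in> {1..d}" for k m
  proof -
    define t where "t = T k"
    define u where "u = N k m"
    have t: "0 < t" and u: "0 < u" and ut: "Z k m \<le> t - u"
      using T_pos[of k] N_ge1[OF m, of k] N_add_Z_le_T[OF m, of k] by (simp_all add: t_def u_def del: T_pos)
    \<comment> \<open>The linear function of \<open>u\<close> is the tangent of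
      \<open>(D - 1) / u\<close> at \<open>u = t * (D - 1) / D\<close>, so the gap is a perfect
      square over a positive quantity.\<close>
    have "(D - 1) / u - (2 * D / t - \<kappa> * u / t\<^sup>2) = ((D - 1) * t - D * u)\<^sup>2 / ((D - 1) * u * t\<^sup>2)"
      using t u D by (simp add: \<kappa>_def divide_simps) (simp add: algebra_simps power2_eq_square)
    also have "\<dots> \<ge> 0" using t u D by simp
    finally have "2 * D / t - \<kappa> * u / t\<^sup>2 \<le> (D - 1) / u" by simp
    moreover have "(2 * D - \<kappa>) / t + \<kappa> * Z k m / t\<^sup>2 \<le> 2 * D / t - \<kappa> * u / t\<^sup>2"
    proof -
      have "\<kappa> * Z k m / t\<^sup>2 \<le> \<kappa> * (t - u) / t\<^sup>2"
        using ut \<kappa>(2) by (intro divide_right_mono mult_left_mono) auto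
      also have "\<dots> = \<kappa> / t - \<kappa> * u / t\<^sup>2"
        using t by (simp add: divide_simps power2_eq_square algebra_simps)
      finally show ?thesis by (simp add: diff_divide_distrib)
    qed
    ultimately have "(2 * D - \<kappa>) / t + \<kappa> * Z k m / t\<^sup>2 \<le> (D - 1) / u" by linarith
    then have "A k m * ((2 * D - \<kappa>) / t + \<kappa> * Z k m / t\<^sup>2) \<le> A k m * ((D - 1) / u)"
      by (intro mult_left_mono) auto
    then show ?thesis by (simp add: t_def u_def distrib_left mult_ac)
  qed
  \<comment> \<open>Summing \<open>ln_Z_ge\<close> over \<open>i\<close> counts each interior visit
    \<open>D - 1\<close> times, and each logarithm is at most \<open>ln (T n)\<close>, hence at most
    \<open>ln (T 0) + H n\<close>. The tangent bound leaves \<open>H n\<close> with the coefficient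
    \<open>D - (2 * D - \<kappa>) = \<kappa> / D\<close>.\<close>
  have key: "\<kappa> * (\<Sum>k<n. P k) \<le> \<kappa> / D * H n + (c' + (2 * D - \<kappa>) * cB + D * ln (T 0))" for n
  proof -
    let ?F = "\<lambda>k. \<Sum>m\<in>{1..d}. A k m / N k m"
    have "(\<Sum>i\<in>{1..d}. (\<Sum>k<n. \<Sum>m\<in>{1..d} - {i}. A k m / N k m)) = (\<Sum>k<n. (D - 1) * ?F k)"
    proof -
      have "(\<Sum>i\<in>{1..d}. (\<Sum>k<n. \<Sum>m\<in>{1..d} - {i}. A k m / N k m))
          = (\<Sum>k<n. \<Sum>i\<in>{1..d}. ?F k - A k i / N k i)"
        by (subst sum.swap) (intro sum.cong refl, simp add: sum_diff1)
      also have "\<dots> = (\<Sum>k<n. (D - 1) * ?F k)"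
        by (simp add: sum_subtractf D_def algebra_simps)
      finally show ?thesis .
    qed
    moreover have "(\<Sum>i\<in>{1..d}. (\<Sum>k<n. \<Sum>m\<in>{1..d} - {i}. A k m / N k m) - c i) \<le> (\<Sum>i\<in>{1..d}. ln (T n))"
    proof (rule sum_mono)
      fix i assume i: "i \<in> {1..d}"
      have "ln (Z n i) \<le> ln (T n)" using Z_ge1[OF i, of n] Z_le_T[OF i, of n] by simp
      then show "(\<Sum>k<n. \<Sum>m\<in>{1..d} - {i}. A k m / N k m) - c i \<le> ln (T n)"
        using c[OF i, of n] by linarith
    qed
    ultimately have 1: "(\<Sum>k<n. (D - 1) * ?F k) - c' \<le> D * ln (T n)"
      by (simp add: sum_subtractf c'_def D_def)
    have 2: "ln (T n) \<le> ln (T 0) + H n"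
      unfolding H_def using unit_step_ln_bounds(2)[of T "\<lambda>_. 1" n] T_Suc T_ge1 by simp
    have 3: "(\<Sum>k<n. (2 * D - \<kappa>) * ((\<Sum>m\<in>{1..d}. A k m) / T k) + \<kappa> * P k) \<le> (\<Sum>k<n. (D - 1) * ?F k)"
    proof (rule sum_mono)
      fix k
      have "(2 * D - \<kappa>) * ((\<Sum>m\<in>{1..d}. A k m) / T k) + \<kappa> * P k
        = (\<Sum>m\<in>{1..d}. (2 * D - \<kappa>) * (A k m / T k) + \<kappa> * (A k m * Z k m / (T k)\<^sup>2))"
        unfolding P_def sum.distrib sum_distrib_left sum_divide_distrib ..
      also have "\<dots> \<le> (\<Sum>m\<in>{1..d}. (D - 1) * (A k m / N k m))"
        by (intro sum_mono tangent)
      finally show "(2 * D - \<kappa>) * ((\<Sum>m\<in>{1..d}. A k m) / T k) + \<kappa> * P k \<le> (D - 1) * ?F k"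
        by (simp only: sum_distrib_left)
    qed
    have "(\<Sum>k<n. (\<Sum>m\<in>{1..d}. A k m) / T k) = H n - (\<Sum>k<n. (\<Sum>i\<in>{1..d}. B k i) / T k)"
    proof -
      have "(\<Sum>m\<in>{1..d}. A k m) = 1 - (\<Sum>i\<in>{1..d}. B k i)" for k
        using one_place[of k] unfolding sum.distrib by linarith
      then show ?thesis by (simp only: H_def diff_divide_distrib sum_subtractf)
    qed
    then have "H n - cB \<le> (\<Sum>k<n. (\<Sum>m\<in>{1..d}. A k m) / T k)" using cB[of n] by linarith
    then have 4: "(2 * D - \<kappa>) * (H n - cB) \<le> (2 * D - \<kappa>) * (\<Sum>k<n. (\<Sum>m\<in>{1..d}. A k m) / T k)"
      using \<kappa>(1) by (intro mult_left_mono) auto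
    have 5: "D * ln (T n) \<le> D * (ln (T 0) + H n)" using 2 D by (intro mult_left_mono) auto
    from 1 3 4 5 have "(2 * D - \<kappa>) * (H n - cB) + \<kappa> * (\<Sum>k<n. P k) - c' \<le> D * (ln (T 0) + H n)"
      unfolding sum.distrib sum_distrib_left[symmetric] by linarith
    then have "\<kappa> * (\<Sum>k<n. P k) \<le> (\<kappa> - D) * H n + (c' + (2 * D - \<kappa>) * cB + D * ln (T 0))"
      by (simp add: algebra_simps)
    then show ?thesis by (simp only: \<kappa>(3))
  qed
  define E where "E = (c' + (2 * D - \<kappa>) * cB + D * ln (T 0)) / \<kappa>"
  have P_le: "(\<Sum>k<n. P k) \<le> H n / D + E" for n
  proof -
    have "\<kappa> * (\<Sum>k<n. P k) \<le> \<kappa> * (H n / D + E)"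
      using key[of n] \<kappa>(2) unfolding E_def distrib_left by simp
    then show ?thesis using \<kappa>(2) by simp
  qed
  \<comment> \<open>The interior proportions sum to \<open>1 - \<Lambda> k / T k\<close>, which
    produces the leaf term.\<close>
  have dev: "(\<Sum>i\<in>{1..d}. (Z k i / T k - 1 / D)\<^sup>2) = (\<Sum>i\<in>{1..d}. (Z k i / T k)\<^sup>2) - 1 / D + 2 / D * (\<Lambda> k / T k)" for k
  proof -
    have "(\<Sum>i\<in>{1..d}. (Z k i / T k - 1 / D)\<^sup>2)
      = (\<Sum>i\<in>{1..d}. (Z k i / T k)\<^sup>2 - 2 / D * (Z k i / T k) + 1 / D\<^sup>2)"
      by (intro sum.cong) (auto simp: power2_diff power_divide)
    also have "\<dots> = (\<Sum>i\<in>{1..d}. (Z k i / T k)\<^sup>2) - 2 / D * ((\<Sum>i\<in>{1..d}. Z k i) / T k) + D * (1 / D\<^sup>2)"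
      by (simp add: sum.distrib sum_subtractf D_def flip: sum_distrib_left sum_divide_distrib)
    also have "D * (1 / D\<^sup>2) = 1 / D" using D by (simp add: power2_eq_square)
    also have "(\<Sum>i\<in>{1..d}. Z k i) / T k = 1 - \<Lambda> k / T k"
    proof -
      have "(\<Sum>i\<in>{1..d}. Z k i) = T k - \<Lambda> k" by (simp add: T_def \<Lambda>_def sum.distrib)
      then show ?thesis using T_pos[of k] by (simp add: diff_divide_distrib)
    qed
    finally show ?thesis by (simp add: algebra_simps)
  qed
  have "(\<Sum>k<n. (\<Sum>i\<in>{1..d}. (Z k i / T k - 1 / D)\<^sup>2) / T k) \<le> 6 + E + 2 / D * cL" for n
  proof -
    have "(\<Sum>k<n. (\<Sum>i\<in>{1..d}. (Z k i / T k - 1 / D)\<^sup>2) / T k)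
      = (\<Sum>k<n. (\<Sum>i\<in>{1..d}. (Z k i / T k)\<^sup>2) / T k) - H n / D + 2 / D * (\<Sum>k<n. \<Lambda> k / (T k)\<^sup>2)"
      unfolding dev H_def sum_distrib_left sum_divide_distrib sum_subtractf[symmetric] sum.distrib[symmetric]
      by (intro sum.cong) (auto simp: add_divide_distrib diff_divide_distrib power2_eq_square mult_ac sum_divide_distrib)
    \<comment> \<open>\<open>energy_le_visits\<close> and \<open>P_le\<close> bound the energy by
      \<open>H (Suc n) / D\<close>, so the diverging harmonic sums cancel except for one last
      term.\<close>
    also have "\<dots> \<le> (H (Suc n) / D + E + 5) - H n / D + 2 / D * cL"
    proof -
      have "2 / D * (\<Sum>k<n. \<Lambda> k / (T k)\<^sup>2) \<le> 2 / D * cL"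
        using cL[of n] D by (intro mult_left_mono) auto
      then show ?thesis using energy_le_visits[of n] P_le[of "Suc n"] unfolding P_def by linarith
    qed
    also have "\<dots> \<le> 6 + E + 2 / D * cL"
    proof -
      have "1 / T n / D \<le> 1"
        using mult_mono[of 1 "T n" 1 D] T_ge1[of n] D by (simp add: divide_le_eq)
      then show ?thesis by (simp add: H_def add_divide_distrib)
    qed
    finally show ?thesis .
  qed
  then show ?thesis unfolding D_def by blast
qed

section \<open>From summability to convergence of the proportions\<close>

text \<open>The increment equals \<open>(e - Y k / T k) / T (Suc k)\<close>, and both terms of the
  numerator lie in the unit interval.\<close>

lemma ratio_variation:
  assumes Y: "0 \<le> Y k" "Y k \<le> T k" and e: "0 \<le> e" "e \<le> 1" "Y (Suc k) = Y k + e"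
  shows "\<bar>Y (Suc k) / T (Suc k) - Y k / T k\<bar> \<le> 1 / T k"
proof -
  have "Y (Suc k) / T (Suc k) - Y k / T k = (e - Y k / T k) / T (Suc k)"
    using T_pos[of k] by (simp add: T_Suc e divide_simps) (simp add: algebra_simps)
  moreover have "\<bar>e - Y k / T k\<bar> \<le> 1"
  proof -
    have "0 \<le> Y k / T k" "Y k / T k \<le> 1" using Y by (auto simp: divide_le_eq)
    then show ?thesis using e by linarith
  qed
  ultimately have "\<bar>Y (Suc k) / T (Suc k) - Y k / T k\<bar> \<le> 1 / T (Suc k)"
    by (simp add: abs_divide abs_of_pos divide_right_mono)
  also have "\<dots> \<le> 1 / T k" by (intro divide_left_mono mult_pos_pos T_pos) (auto simp: T_Suc)
  finally show ?thesis .
qed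

theorem leaf_proportion_tendsto:
  assumes i: "i \<in> {1..d}"
  shows "(\<lambda>k. L k i / T k) \<longlonglongrightarrow> 0"
proof -
  obtain C where C: "\<And>n. (\<Sum>k<n. L k i / (T k)\<^sup>2) \<le> C"
    using sum_L_over_T_squared[OF i] by blast
  show ?thesis
  proof (rule slowly_varying_tendsto_zero[of T _ 1 C])
    show "\<bar>L (Suc k) i / T (Suc k) - L k i / T k\<bar> \<le> 1 / T k" for k
      using ratio_variation[of "\<lambda>k. L k i" k "B (Suc k) i"] L_nonneg[OF i] L_le_T[OF i] L_Suc[OF i] B01[of "Suc k" i]
      by auto
    show "(\<Sum>k<n. L k i / T k / T k) \<le> C" for n
      using C[of n] by (simp add: power2_eq_square)
    show "0 \<le> L k i / T k" for k using L_nonneg[OF i, of k] T_pos[of k] by simp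
  qed (use T_Suc T_ge1 in auto)
qed

text \<open>\<open>slowly_varying_tendsto_zero\<close> is applied to the square of the deviation,
  the quantity known to be summable against \<open>1 / T\<close>. As deviations are at most 1, the
  square varies by at most \<open>2 / T k\<close>.\<close>

theorem inner_proportion_tendsto:
  assumes i: "i \<in> {1..d}"
  shows "(\<lambda>k. Z k i / T k) \<longlonglongrightarrow> 1 / real d"
proof -
  let ?y = "\<lambda>k. Z k i / T k - 1 / real d"
  obtain C where C: "\<And>n. (\<Sum>k<n. (\<Sum>i\<in>{1..d}. (Z k i / T k - 1 / real d)\<^sup>2) / T k) \<le> C"
    using sum_square_deviation_over_T by blast
  have y1: "\<bar>?y k\<bar> \<le> 1" for k
  proof -
    have "0 \<le> Z k i / T k" "Z k i / T k \<le> 1" "0 \<le> 1 / real d" "1 / real d \<le> 1"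
      using Z_ge1[OF i, of k] Z_le_T[OF i, of k] T_pos[of k] d3 by (auto simp: divide_le_eq)
    then show ?thesis by linarith
  qed
  have "(\<lambda>k. (?y k)\<^sup>2) \<longlonglongrightarrow> 0"
  proof (rule slowly_varying_tendsto_zero[of T _ 2 C])
    fix k
    have "\<bar>(?y (Suc k))\<^sup>2 - (?y k)\<^sup>2\<bar> = \<bar>?y (Suc k) - ?y k\<bar> * \<bar>?y (Suc k) + ?y k\<bar>"
      by (simp only: power2_eq_square square_diff_square_factored abs_mult mult.commute)
    also have "\<dots> \<le> 1 / T k * 2"
    proof (rule mult_mono)
      show "\<bar>?y (Suc k) - ?y k\<bar> \<le> 1 / T k"
        using ratio_variation[of "\<lambda>k. Z k i" k "A (Suc k) i"] Z_ge1[OF i, of k] Z_le_T[OF i] Z_Suc[OF i] A01[of "Suc k" i]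
        by auto
      show "\<bar>?y (Suc k) + ?y k\<bar> \<le> 2" using y1[of k] y1[of "Suc k"] by linarith
    qed (use T_pos[of k] in auto)
    finally show "\<bar>(?y (Suc k))\<^sup>2 - (?y k)\<^sup>2\<bar> \<le> 2 / T k" by simp
  next
    fix n
    have "(\<Sum>k<n. (?y k)\<^sup>2 / T k) \<le> (\<Sum>k<n. (\<Sum>i\<in>{1..d}. (Z k i / T k - 1 / real d)\<^sup>2) / T k)"
    proof (intro sum_mono divide_right_mono)
      show "(?y k)\<^sup>2 \<le> (\<Sum>i\<in>{1..d}. (Z k i / T k - 1 / real d)\<^sup>2)" for k
        using i by (intro member_le_sum[where f = "\<lambda>i. (Z k i / T k - 1 / real d)\<^sup>2"]) auto
    qed (simp add: less_imp_le)
    also have "\<dots> \<le> C" by (rule C)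
    finally show "(\<Sum>k<n. (?y k)\<^sup>2 / T k) \<le> C" .
  qed (use T_Suc T_ge1 in auto)
  then have "?y \<longlonglongrightarrow> 0" by simp
  then show ?thesis by (simp add: LIM_zero_iff)
qed

end

section \<open>Compensated sums of the walk\<close>

text \<open>Countability of the vertices, hence of the histories, makes \<open>hist\<close>
  measurable through singletons and lets almost sure statements range over all histories at
  once.\<close>

instance vtx :: countable
  by countable_datatype

lemma finite_verts [simp]: "finite (verts d r)"
proof -
  have "verts d r = Inner ` {1..d} \<union> (\<Union>i\<in>{1..d}. Leaf i ` {1..r i})"
    by (auto simp: verts_def)
  then show ?thesis by simp
qed

locale vrrw_process = prob_space M for M :: "'w measure" +
  fixes d :: nat and r :: "nat \<Rightarrow> nat" and z0 :: "vtx \<Rightarrow> nat" and x0 :: vtx and X :: "nat \<Rightarrow> 'w \<Rightarrow> vtx"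
  assumes x0: "x0 \<in> verts d r" and law: "vrrw_law M d r z0 x0 X"
begin

section \<open>Histories and admissible paths\<close>

definition hist :: "nat \<Rightarrow> 'w \<Rightarrow> vtx list" where
  "hist n \<omega> = map (\<lambda>s. X s \<omega>) [0..<Suc n]"

lemma length_hist [simp]: "length (hist n \<omega>) = Suc n"
  by (simp add: hist_def)

lemma hist_eq_iff: "hist n \<omega> = h \<longleftrightarrow> length h = Suc n \<and> (\<forall>s\<le>n. X s \<omega> = h ! s)"
  by (auto simp: hist_def list_eq_iff_nth_eq less_Suc_eq_le simp del: upt_Suc)

lemma hist_eq_hist_iff: "hist n \<omega> = hist n \<omega>' \<longleftrightarrow> (\<forall>s\<le>n. X s \<omega> = X s \<omega>')"
  by (auto simp: hist_eq_iff) (auto simp: hist_def simp del: upt_Suc)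

lemma last_hist [simp]: "last (hist n \<omega>) = X n \<omega>"
  by (simp add: hist_def)

lemma X_measurable [measurable]: "X n \<in> measurable M (count_space UNIV)"
  using law by (simp add: vrrw_law_def)

lemma hist_measurable [measurable]: "hist n \<in> measurable M (count_space UNIV)"
proof (subst measurable_count_space_eq2_countable, safe)
  fix h
  have "hist n -` {h} \<inter> space M = {\<omega> \<in> space M. length h = Suc n \<and> (\<forall>s\<in>{..n}. X s \<omega> = h ! s)}"
    by (intro set_eqI) (simp add: hist_eq_iff conj_commute Ball_def)
  also have "\<dots> \<in> sets M" by measurable
  finally show "hist n -` {h} \<inter> space M \<in> sets M" .
qed auto

lemma prob_hist_Suc:
  "prob {\<omega> \<in> space M. hist n \<omega> = h \<and> X (Suc n) \<omega> = w}
   = prob {\<omega> \<in> space M. hist n \<omega> = h} * vrrw_trans d r z0 h w"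
  \<comment> \<open>For \<open>h\<close> of the wrong length both events are empty.\<close>
  using law by (cases "length h = Suc n") (simp_all add: hist_eq_iff vrrw_law_def)

text \<open>Each cylinder ending in a forbidden step is null, and there are countably many of
  them.\<close>

lemma AE_trans_nonzero: "AE \<omega> in M. \<forall>n. vrrw_trans d r z0 (hist n \<omega>) (X (Suc n) \<omega>) \<noteq> 0"
proof -
  have "AE \<omega> in M. \<not> (hist n \<omega> = h \<and> X (Suc n) \<omega> = w)" if "vrrw_trans d r z0 h w = 0" for n h w
    using prob_hist_Suc[of n h w] that by (intro AE_I'[of "{\<omega> \<in> space M. hist n \<omega> = h \<and> X (Suc n) \<omega> = w}"])
      (auto simp: null_sets_def emeasure_eq_measure)
  then have "AE \<omega> in M. \<forall>n h w. vrrw_trans d r z0 h w = 0 \<longrightarrow> \<not> (hist n \<omega> = h \<and> X (Suc n) \<omega> = w)"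
    unfolding AE_all_countable by auto
  then show ?thesis by eventually_elim blast
qed

lemma AE_path: "AE \<omega> in M. (\<forall>n. X n \<omega> \<in> verts d r) \<and> (\<forall>n. adj (X n \<omega>) (X (Suc n) \<omega>))"
proof -
  have "AE \<omega> in M. X 0 \<omega> = x0" using law by (simp add: vrrw_law_def)
  with AE_trans_nonzero show ?thesis
  proof eventually_elim
    case (elim \<omega>)
    have step: "X (Suc n) \<omega> \<in> verts d r" "adj (X n \<omega>) (X (Suc n) \<omega>)" for n
      using elim(1)[rule_format, of n] by (auto simp: vrrw_trans_def split: if_splits)
    moreover have "X n \<omega> \<in> verts d r" for n
      using step elim(2) x0 by (cases n) auto
    ultimately show ?case by blast
  qed
qed

definition paths :: "nat \<Rightarrow> vtx list set" where
  "paths n = {h. set h \<subseteq> verts d r \<and> length h = Suc n}"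

lemma finite_paths [simp]: "finite (paths n)"
  unfolding paths_def by (intro finite_lists_length_eq) simp

lemma AE_hist_paths: "AE \<omega> in M. hist n \<omega> \<in> paths n"
  using AE_path by eventually_elim (auto simp: paths_def hist_def)

section \<open>Functions of the past and the one-step law\<close>

text \<open>Stands for measurability with respect to the positions up to \<open>n\<close>. As
  histories are countable, dependence on the path prefix already gives measurability, and no
  conditional expectations have to be formed.\<close>

definition adapted :: "nat \<Rightarrow> ('w \<Rightarrow> real) \<Rightarrow> bool" where
  "adapted n f \<longleftrightarrow> (\<forall>\<omega> \<omega>'. (\<forall>s\<le>n. X s \<omega> = X s \<omega>') \<longrightarrow> f \<omega> = f \<omega>')"

text \<open>\<open>\<phi>\<close> evaluates \<open>f\<close> at an arbitrary sample point with the
  given history; adaptedness makes the choice irrelevant.\<close>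

lemma adapted_obtain:
  assumes "adapted n f"
  obtains \<phi> where "f = (\<lambda>\<omega>. \<phi> (hist n \<omega>))"
proof
  show "f = (\<lambda>\<omega>. (\<lambda>h. f (SOME \<omega>'. hist n \<omega>' = h)) (hist n \<omega>))"
  proof
    fix \<omega>
    define \<omega>' where "\<omega>' = (SOME \<omega>'. hist n \<omega>' = hist n \<omega>)"
    have "hist n \<omega>' = hist n \<omega>" unfolding \<omega>'_def by (rule someI) simp
    then have "\<forall>s\<le>n. X s \<omega> = X s \<omega>'" by (simp add: hist_eq_hist_iff)
    then have "f \<omega> = f \<omega>'" using assms unfolding adapted_def by blast
    then show "f \<omega> = f (SOME \<omega>'. hist n \<omega>' = hist n \<omega>)" unfolding \<omega>'_def .
  qed
qed

lemma adapted_measurable: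
  assumes "adapted n f"
  shows "f \<in> borel_measurable M"
proof -
  obtain \<phi> where "f = (\<lambda>\<omega>. \<phi> (hist n \<omega>))" using adapted_obtain[OF assms] .
  then show ?thesis by simp
qed

text \<open>Almost surely the history lies in the finite set \<open>paths n\<close>, so an adapted
  function is essentially bounded.\<close>

lemma adapted_integrable:
  assumes "adapted n f"
  shows "integrable M f"
proof -
  obtain \<phi> where \<phi>: "f = (\<lambda>\<omega>. \<phi> (hist n \<omega>))" using adapted_obtain[OF assms] .
  show ?thesis
  proof (rule integrable_const_bound)
    show "AE \<omega> in M. norm (f \<omega>) \<le> (\<Sum>h\<in>paths n. \<bar>\<phi> h\<bar>)"
      using AE_hist_paths[of n]
      by eventually_elim (auto simp: \<phi> intro!: member_le_sum[where f = "\<lambda>h. \<bar>\<phi> h\<bar>"])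
  qed (rule adapted_measurable[OF assms])
qed

lemma adapted_mono: "adapted m f \<Longrightarrow> m \<le> n \<Longrightarrow> adapted n f"
  unfolding adapted_def by (meson le_trans)

lemma adapted_binop:
  assumes "adapted n f" "adapted n g"
  shows "adapted n (\<lambda>\<omega>. F (f \<omega>) (g \<omega>))"
  unfolding adapted_def
proof (intro allI impI)
  fix \<omega> \<omega>' assume "\<forall>s\<le>n. X s \<omega> = X s \<omega>'"
  then have "f \<omega> = f \<omega>'" "g \<omega> = g \<omega>'" using assms unfolding adapted_def by blast+
  then show "F (f \<omega>) (g \<omega>) = F (f \<omega>') (g \<omega>')" by simp
qed

lemma adapted_sum: "(\<And>k. k \<in> S \<Longrightarrow> adapted n (f k)) \<Longrightarrow> adapted n (\<lambda>\<omega>. \<Sum>k\<in>S. f k \<omega>)"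
  unfolding adapted_def by (auto intro!: sum.cong)

lemma adapted_of_bool_X: "s \<le> n \<Longrightarrow> adapted n (\<lambda>\<omega>. of_bool (X s \<omega> \<in> U))"
  by (auto simp: adapted_def)

text \<open>The conditional probability, given the history, that the next step enters
  \<open>U\<close>.\<close>

definition pstep :: "vtx set \<Rightarrow> nat \<Rightarrow> 'w \<Rightarrow> real" where
  "pstep U n \<omega> = (\<Sum>w\<in>verts d r \<inter> U. vrrw_trans d r z0 (hist n \<omega>) w)"

lemma adapted_pstep: "adapted n (pstep U n)"
  unfolding adapted_def pstep_def by (metis hist_eq_hist_iff)

text \<open>The defining property of a conditional probability, tested against \<open>f\<close>.
  Both sides are finite sums over cylinders, on which the law prescribes the product
  formula.\<close>

lemma expectation_step:
  assumes "adapted n f"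
  shows "expectation (\<lambda>\<omega>. f \<omega> * of_bool (X (Suc n) \<omega> \<in> U)) = expectation (\<lambda>\<omega>. f \<omega> * pstep U n \<omega>)"
proof -
  obtain \<phi> where \<phi>: "f = (\<lambda>\<omega>. \<phi> (hist n \<omega>))" using adapted_obtain[OF assms] .
  define E where "E h = {\<omega> \<in> space M. hist n \<omega> = h}" for h
  define F where "F h w = {\<omega> \<in> space M. hist n \<omega> = h \<and> X (Suc n) \<omega> = w}" for h w
  have [measurable]: "E h \<in> sets M" "F h w \<in> sets M" for h w unfolding E_def F_def by measurable
  have intF: "integrable M (\<lambda>\<omega>. c * indicator (F h w) \<omega>)"
    and intE: "integrable M (\<lambda>\<omega>. c * indicator (E h) \<omega>)" for c :: real and h w
    by (simp_all add: emeasure_eq_measure)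
  let ?V = "verts d r \<inter> U"
  have "expectation (\<lambda>\<omega>. f \<omega> * of_bool (X (Suc n) \<omega> \<in> U))
      = expectation (\<lambda>\<omega>. \<Sum>h\<in>paths n. \<Sum>w\<in>?V. \<phi> h * indicator (F h w) \<omega>)"
  proof (intro integral_cong_AE)
    show "(\<lambda>\<omega>. f \<omega> * of_bool (X (Suc n) \<omega> \<in> U)) \<in> borel_measurable M"
      unfolding \<phi> by measurable
    show "AE \<omega> in M. f \<omega> * of_bool (X (Suc n) \<omega> \<in> U) = (\<Sum>h\<in>paths n. \<Sum>w\<in>?V. \<phi> h * indicator (F h w) \<omega>)"
      using AE_hist_paths[of n] AE_path AE_space
    proof eventually_elim
      case (elim \<omega>)
      have "(\<Sum>h\<in>paths n. \<Sum>w\<in>?V. \<phi> h * indicator (F h w) \<omega>)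
          = (\<Sum>h\<in>paths n. if h = hist n \<omega> then (\<Sum>w\<in>?V. if w = X (Suc n) \<omega> then \<phi> h else 0) else 0)"
        using elim(3) by (intro sum.cong) (auto simp: F_def indicator_def intro!: sum.neutral sum.cong)
      also have "\<dots> = f \<omega> * of_bool (X (Suc n) \<omega> \<in> U)"
        using elim by (simp add: sum.delta \<phi>)
      finally show ?case by simp
    qed
  qed measurable
  also have "\<dots> = (\<Sum>h\<in>paths n. \<Sum>w\<in>?V. \<phi> h * prob (F h w))"
    by (subst Bochner_Integration.integral_sum, intro Bochner_Integration.integrable_sum intF,
        intro sum.cong refl, subst Bochner_Integration.integral_sum, rule intF, simp)
  also have "\<dots> = (\<Sum>h\<in>paths n. \<phi> h * (\<Sum>w\<in>?V. vrrw_trans d r z0 h w) * prob (E h))"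
    unfolding F_def E_def prob_hist_Suc by (simp add: sum_distrib_left sum_distrib_right mult_ac)
  also have "\<dots> = expectation (\<lambda>\<omega>. \<Sum>h\<in>paths n. \<phi> h * (\<Sum>w\<in>?V. vrrw_trans d r z0 h w) * indicator (E h) \<omega>)"
    by (subst Bochner_Integration.integral_sum, rule intE) simp
  also have "\<dots> = expectation (\<lambda>\<omega>. f \<omega> * pstep U n \<omega>)"
  proof (intro integral_cong_AE)
    show "(\<lambda>\<omega>. f \<omega> * pstep U n \<omega>) \<in> borel_measurable M"
      using adapted_binop[OF assms adapted_pstep, of "(*)"] by (rule adapted_measurable)
    show "AE \<omega> in M. (\<Sum>h\<in>paths n. \<phi> h * (\<Sum>w\<in>?V. vrrw_trans d r z0 h w) * indicator (E h) \<omega>) = f \<omega> * pstep U n \<omega>"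
      using AE_hist_paths[of n] AE_space
    proof eventually_elim
      case (elim \<omega>)
      have "(\<Sum>h\<in>paths n. \<phi> h * (\<Sum>w\<in>?V. vrrw_trans d r z0 h w) * indicator (E h) \<omega>)
          = (\<Sum>h\<in>paths n. if h = hist n \<omega> then \<phi> h * (\<Sum>w\<in>?V. vrrw_trans d r z0 h w) else 0)"
        using elim(2) by (intro sum.cong) (auto simp: E_def indicator_def)
      also have "\<dots> = f \<omega> * pstep U n \<omega>" using elim by (simp add: sum.delta \<phi> pstep_def)
      finally show ?case .
    qed
  qed measurable
  finally show ?thesis .
qed

section \<open>Martingale transforms and their boundedness\<close>

text \<open>Martingale transform of the visits to \<open>U\<close>: the coefficient
  \<open>g k\<close> multiplies the step from \<open>k\<close> to \<open>k + 1\<close>, so it is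
  predictable when \<open>g k\<close> is adapted at \<open>k\<close>.\<close>

definition compensated :: "vtx set \<Rightarrow> (nat \<Rightarrow> 'w \<Rightarrow> real) \<Rightarrow> nat \<Rightarrow> 'w \<Rightarrow> real" where
  "compensated U g n \<omega> = (\<Sum>k<n. g k \<omega> * (of_bool (X (Suc k) \<omega> \<in> U) - pstep U k \<omega>))"

lemma adapted_compensated:
  assumes g: "\<And>k. adapted k (g k)" and "n \<le> m"
  shows "adapted m (compensated U g n)"
  unfolding compensated_def
proof (rule adapted_sum)
  fix k assume k: "k \<in> {..<n}"
  have "adapted m (\<lambda>\<omega>. of_bool (X (Suc k) \<omega> \<in> U) - pstep U k \<omega>)"
    using k assms(2) by (intro adapted_binop[where F = "(-)"] adapted_of_bool_X adapted_mono[OF adapted_pstep]) auto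
  then show "adapted m (\<lambda>\<omega>. g k \<omega> * (of_bool (X (Suc k) \<omega> \<in> U) - pstep U k \<omega>))"
    using k assms(2) by (intro adapted_binop[where F = "(*)"] adapted_mono[OF g]) auto
qed

text \<open>Increments are orthogonal to the past, and the conditional variance
  \<open>p - p^2\<close> is at most \<open>p\<close>. The bound is expressed by actual visits, whose
  weighted sums are controlled path by path in the applications.\<close>

lemma compensated_second_moment:
  assumes g: "\<And>k. adapted k (g k)"
  shows "expectation (\<lambda>\<omega>. (compensated U g n \<omega>)\<^sup>2)
    \<le> expectation (\<lambda>\<omega>. \<Sum>k<n. (g k \<omega>)\<^sup>2 * of_bool (X (Suc k) \<omega> \<in> U))"
proof (induction n)
  case 0
  then show ?case by (simp add: compensated_def)
next
  case (Suc n)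
  let ?C = "compensated U g n" and ?u = "\<lambda>\<omega>. of_bool (X (Suc n) \<omega> \<in> U) :: real" and ?p = "pstep U n"
  let ?f1 = "\<lambda>\<omega>. 2 * ?C \<omega> * g n \<omega>" and ?f2 = "\<lambda>\<omega>. (g n \<omega>)\<^sup>2 * ?p \<omega>"
  have aC: "adapted n ?C" using g by (rule adapted_compensated) simp
  have a1: "adapted n ?f1" and a2: "adapted n ?f2" and a3: "adapted n (\<lambda>\<omega>. (g n \<omega>)\<^sup>2)"
    using adapted_binop[OF aC g, of "\<lambda>x y. 2 * x * y"]
      adapted_binop[OF g[of n] adapted_pstep, where F = "\<lambda>x y. x\<^sup>2 * y"]
      adapted_binop[OF g[of n] g[of n], where F = "\<lambda>x y. x\<^sup>2"] by simp_all
  have aS: "adapted (Suc n) (\<lambda>\<omega>. f \<omega> * ?u \<omega>)" if "adapted n f" for f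
    using that by (intro adapted_binop[where F = "(*)"] adapted_of_bool_X) (auto intro: adapted_mono)
  have aP: "adapted n (\<lambda>\<omega>. f \<omega> * ?p \<omega>)" if "adapted n f" for f
    using that by (intro adapted_binop[where F = "(*)"] adapted_pstep)
  note int = adapted_integrable[OF aS[OF a1]] adapted_integrable[OF aP[OF a1]]
    adapted_integrable[OF aS[OF a2]] adapted_integrable[OF aP[OF a2]] adapted_integrable[OF aS[OF a3]]
  have intC: "integrable M (\<lambda>\<omega>. (?C \<omega>)\<^sup>2)"
    using adapted_binop[OF aC aC, where F = "\<lambda>x y. x\<^sup>2"] by (auto intro: adapted_integrable)
  have intS: "integrable M (\<lambda>\<omega>. \<Sum>k<n. (g k \<omega>)\<^sup>2 * of_bool (X (Suc k) \<omega> \<in> U))"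
    by (intro Bochner_Integration.integrable_sum adapted_integrable[of "Suc _"]
        adapted_binop[where F = "\<lambda>x y. x\<^sup>2 * y"] adapted_of_bool_X) (auto intro: adapted_mono[OF g])
  \<comment> \<open>Uses that the indicator \<open>?u\<close> equals its square. The first bracket
    has mean zero, and \<open>?f2\<close> has the same mean against \<open>?u\<close> and against
    \<open>?p\<close>.\<close>
  have "(compensated U g (Suc n) \<omega>)\<^sup>2 = (?C \<omega>)\<^sup>2 + (?f1 \<omega> * ?u \<omega> - ?f1 \<omega> * ?p \<omega>)
     + ((g n \<omega>)\<^sup>2 * ?u \<omega> - 2 * (?f2 \<omega> * ?u \<omega>) + ?f2 \<omega> * ?p \<omega>)" for \<omega>
    by (cases "X (Suc n) \<omega> \<in> U") (simp_all add: compensated_def power2_eq_square algebra_simps)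
  then have "expectation (\<lambda>\<omega>. (compensated U g (Suc n) \<omega>)\<^sup>2)
     = expectation (\<lambda>\<omega>. (?C \<omega>)\<^sup>2) + (expectation (\<lambda>\<omega>. ?f1 \<omega> * ?u \<omega>) - expectation (\<lambda>\<omega>. ?f1 \<omega> * ?p \<omega>))
     + (expectation (\<lambda>\<omega>. (g n \<omega>)\<^sup>2 * ?u \<omega>) - 2 * expectation (\<lambda>\<omega>. ?f2 \<omega> * ?u \<omega>) + expectation (\<lambda>\<omega>. ?f2 \<omega> * ?p \<omega>))"
    using int intC by simp
  also have "\<dots> = expectation (\<lambda>\<omega>. (?C \<omega>)\<^sup>2) + expectation (\<lambda>\<omega>. (g n \<omega>)\<^sup>2 * ?u \<omega>) - expectation (\<lambda>\<omega>. ?f2 \<omega> * ?p \<omega>)"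
    unfolding expectation_step[OF a1] expectation_step[OF a2] by simp
  also have "\<dots> \<le> expectation (\<lambda>\<omega>. (?C \<omega>)\<^sup>2) + expectation (\<lambda>\<omega>. (g n \<omega>)\<^sup>2 * ?u \<omega>)"
  proof -
    have "0 \<le> expectation (\<lambda>\<omega>. ?f2 \<omega> * ?p \<omega>)"
      by (intro Bochner_Integration.integral_nonneg) (simp add: mult.assoc flip: power2_eq_square)
    then show ?thesis by simp
  qed
  also have "\<dots> \<le> expectation (\<lambda>\<omega>. \<Sum>k<Suc n. (g k \<omega>)\<^sup>2 * of_bool (X (Suc k) \<omega> \<in> U))"
    using Suc int(5) intS by simp
  finally show ?case .
qed

text \<open>Stopping the transform when it first reaches K keeps it a transform with adapted
  coefficients, so that Chebyshev's inequality for the stopped one replaces a maximal inequality.\<close>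

lemma compensated_maximal:
  assumes g: "\<And>k. adapted k (g k)" and K: "0 < K"
    and bdd: "AE \<omega> in M. (\<Sum>k<n. (g k \<omega>)\<^sup>2 * of_bool (X (Suc k) \<omega> \<in> U)) \<le> C"
  shows "prob {\<omega> \<in> space M. \<exists>j\<le>n. K \<le> \<bar>compensated U g j \<omega>\<bar>} \<le> C / K\<^sup>2"
proof -
  let ?C = "compensated U g"
  define g' where "g' k \<omega> = g k \<omega> * of_bool (\<forall>j\<le>k. \<bar>?C j \<omega>\<bar> < K)" for k \<omega>
  have g': "adapted k (g' k)" for k
  proof -
    have "adapted k (\<lambda>\<omega>. of_bool (\<forall>j\<le>k. \<bar>?C j \<omega>\<bar> < K))"
      unfolding adapted_def
    proof (intro allI impI)
      fix \<omega> \<omega>' assume "\<forall>s\<le>k. X s \<omega> = X s \<omega>'"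
      then have "?C j \<omega> = ?C j \<omega>'" if "j \<le> k" for j
        using adapted_compensated[of g j k U, OF g that] unfolding adapted_def by blast
      then show "of_bool (\<forall>j\<le>k. \<bar>?C j \<omega>\<bar> < K) = (of_bool (\<forall>j\<le>k. \<bar>?C j \<omega>'\<bar> < K) :: real)"
        by simp
    qed
    then show ?thesis unfolding g'_def using g by (intro adapted_binop[where F = "(*)"])
  qed
  have stopped: "K \<le> \<bar>compensated U g' n \<omega>\<bar>" if ex: "\<exists>j\<le>n. K \<le> \<bar>?C j \<omega>\<bar>" for \<omega>
  proof -
    \<comment> \<open>At the first passage \<open>j\<close> the coefficients before \<open>j\<close>
      are unchanged and those from \<open>j\<close> on vanish, so the stopped sum is frozen at
      \<open>?C j\<close>.\<close>
    define j where "j = (LEAST j. K \<le> \<bar>?C j \<omega>\<bar>)"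
    have j: "K \<le> \<bar>?C j \<omega>\<bar>" unfolding j_def using ex by (metis (mono_tags, lifting) LeastI)
    have less: "\<bar>?C i \<omega>\<bar> < K" if "i < j" for i
      using not_less_Least that unfolding j_def by (meson not_le)
    have "j \<le> n" unfolding j_def using ex by (meson Least_le le_trans)
    have "compensated U g' n \<omega> = compensated U g' j \<omega>"
      unfolding compensated_def using \<open>j \<le> n\<close> j
      by (intro sum.mono_neutral_right) (auto simp: g'_def not_less)
    also have "\<dots> = ?C j \<omega>"
      unfolding compensated_def using less by (intro sum.cong) (auto simp: g'_def)
    finally show ?thesis using j by simp
  qed
  define E where "E = {\<omega> \<in> space M. \<exists>j\<le>n. K \<le> \<bar>?C j \<omega>\<bar>}"
  have meas: "E \<in> sets M"
  proof -
    have [measurable]: "?C j \<in> borel_measurable M" for j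
      using adapted_measurable[OF adapted_compensated[OF g order_refl]] .
    have "E = {\<omega> \<in> space M. \<exists>j\<in>{..n}. K \<le> \<bar>?C j \<omega>\<bar>}" by (auto simp: E_def)
    also have "\<dots> \<in> sets M" by measurable
    finally show ?thesis .
  qed
  have int: "integrable M (\<lambda>\<omega>. (compensated U g' n \<omega>)\<^sup>2)"
    using adapted_binop[OF adapted_compensated[of g' n n U, OF g' order_refl]
        adapted_compensated[of g' n n U, OF g' order_refl], where F = "\<lambda>x y. x\<^sup>2"]
    by (auto intro: adapted_integrable)
  have "K\<^sup>2 * prob E = expectation (\<lambda>\<omega>. K\<^sup>2 * indicator E \<omega>)"
    using meas by simp
  also have "\<dots> \<le> expectation (\<lambda>\<omega>. (compensated U g' n \<omega>)\<^sup>2)"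
  proof (rule integral_mono)
    show "integrable M (\<lambda>\<omega>. K\<^sup>2 * indicator E \<omega>)" using meas by (simp add: emeasure_eq_measure)
    show "K\<^sup>2 * indicator E \<omega> \<le> (compensated U g' n \<omega>)\<^sup>2" for \<omega>
      using stopped[of \<omega>] K power_mono[of K "\<bar>compensated U g' n \<omega>\<bar>" 2] by (auto simp: indicator_def E_def)
  qed (rule int)
  also have "\<dots> \<le> expectation (\<lambda>\<omega>. \<Sum>k<n. (g' k \<omega>)\<^sup>2 * of_bool (X (Suc k) \<omega> \<in> U))"
    using g' by (rule compensated_second_moment)
  also have "\<dots> \<le> expectation (\<lambda>\<omega>. C)"
  proof (rule integral_mono_AE)
    show "integrable M (\<lambda>\<omega>. \<Sum>k<n. (g' k \<omega>)\<^sup>2 * of_bool (X (Suc k) \<omega> \<in> U))"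
      by (intro Bochner_Integration.integrable_sum adapted_integrable[of "Suc _"]
        adapted_binop[where F = "\<lambda>x y. x\<^sup>2 * y"] adapted_of_bool_X) (auto intro: adapted_mono[OF g'])
    show "AE \<omega> in M. (\<Sum>k<n. (g' k \<omega>)\<^sup>2 * of_bool (X (Suc k) \<omega> \<in> U)) \<le> C"
      using bdd
    proof eventually_elim
      case (elim \<omega>)
      have "(\<Sum>k<n. (g' k \<omega>)\<^sup>2 * of_bool (X (Suc k) \<omega> \<in> U)) \<le> (\<Sum>k<n. (g k \<omega>)\<^sup>2 * of_bool (X (Suc k) \<omega> \<in> U))"
        by (intro sum_mono mult_right_mono) (auto simp: g'_def)
      with elim show ?case by linarith
    qed
  qed simp
  finally show ?thesis unfolding E_def[symmetric] using K by (simp add: prob_space le_divide_eq mult.commute)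
qed

text \<open>An unbounded path crosses every level \<open>m + 1\<close>. By continuity from below the
  maximal inequality extends to the infinite horizon, and its bound tends to 0 as the level
  grows.\<close>

lemma compensated_AE_bounded:
  assumes g: "\<And>k. adapted k (g k)"
    and bdd: "AE \<omega> in M. \<forall>n. (\<Sum>k<n. (g k \<omega>)\<^sup>2 * of_bool (X (Suc k) \<omega> \<in> U)) \<le> C"
  shows "AE \<omega> in M. \<exists>K. \<forall>n. \<bar>compensated U g n \<omega>\<bar> \<le> K"
proof -
  let ?C = "compensated U g"
  have [measurable]: "?C j \<in> borel_measurable M" for j
    using adapted_measurable[OF adapted_compensated[OF g order_refl]] .
  define E where "E K n = {\<omega> \<in> space M. \<exists>j\<le>n. K \<le> \<bar>?C j \<omega>\<bar>}" for K :: real and n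
  have E_alt: "E K n = {\<omega> \<in> space M. \<exists>j\<in>{..n}. K \<le> \<bar>?C j \<omega>\<bar>}" for K n by (auto simp: E_def)
  have E_sets [measurable]: "E K n \<in> sets M" for K n unfolding E_alt by measurable
  define B where "B = {\<omega> \<in> space M. \<forall>m::nat. \<exists>j. real (Suc m) \<le> \<bar>?C j \<omega>\<bar>}"
  have B_sets [measurable]: "B \<in> sets M" unfolding B_def by measurable
  have "prob B \<le> C / (real (Suc m))\<^sup>2" for m
  proof -
    have "(\<lambda>n. prob (E (real (Suc m)) n)) \<longlonglongrightarrow> prob (\<Union>n. E (real (Suc m)) n)"
    proof (rule finite_Lim_measure_incseq)
      show "incseq (E (real (Suc m)))" unfolding incseq_def E_def by (auto intro: le_trans)
    qed auto
    moreover have "prob (E (real (Suc m)) n) \<le> C / (real (Suc m))\<^sup>2" for n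
      unfolding E_def using bdd by (intro compensated_maximal g) auto
    ultimately have "prob (\<Union>n. E (real (Suc m)) n) \<le> C / (real (Suc m))\<^sup>2"
      by (intro LIMSEQ_le_const2) auto
    moreover have "B \<subseteq> (\<Union>n. E (real (Suc m)) n)" unfolding B_def E_def by blast
    then have "prob B \<le> prob (\<Union>n. E (real (Suc m)) n)" by (intro finite_measure_mono) auto
    ultimately show ?thesis by linarith
  qed
  moreover have "(\<lambda>m. C / (real (Suc m))\<^sup>2) \<longlonglongrightarrow> 0"
    using tendsto_mult[OF tendsto_const[of C] tendsto_power[OF LIMSEQ_inverse_real_of_nat, of 2]]
    by (simp add: divide_inverse power_inverse)
  ultimately have "prob B \<le> 0" by (intro LIMSEQ_le_const) auto
  then have "B \<in> null_sets M" by (auto simp: null_sets_def emeasure_eq_measure measure_le_0_iff)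
  then show ?thesis
  proof (rule AE_I')
    show "{\<omega> \<in> space M. \<not> (\<exists>K. \<forall>n. \<bar>?C n \<omega>\<bar> \<le> K)} \<subseteq> B"
      unfolding B_def by (auto simp: not_le) (meson less_imp_le)
  qed
qed

end

section \<open>Almost sure convergence\<close>

lemma sum_verts:
  "(\<Sum>v\<in>verts d r. f v) = (\<Sum>i\<in>{1..d}. f (Inner i) + (\<Sum>m\<in>{1..r i}. f (Leaf i m)))"
  for f :: "vtx \<Rightarrow> 'b::comm_monoid_add"
proof -
  have "verts d r = (\<Union>i\<in>{1..d}. insert (Inner i) (Leaf i ` {1..r i}))"
    by (auto simp: verts_def)
  also have "(\<Sum>v\<in>\<dots>. f v) = (\<Sum>i\<in>{1..d}. \<Sum>v\<in>insert (Inner i) (Leaf i ` {1..r i}). f v)"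
    by (intro sum.UNION_disjoint) auto
  also have "\<dots> = (\<Sum>i\<in>{1..d}. f (Inner i) + (\<Sum>m\<in>{1..r i}. f (Leaf i m)))"
  proof (intro sum.cong refl)
    fix i
    have "(\<Sum>v\<in>insert (Inner i) (Leaf i ` {1..r i}). f v) = f (Inner i) + (\<Sum>v\<in>Leaf i ` {1..r i}. f v)"
      by (intro sum.insert) auto
    also have "(\<Sum>v\<in>Leaf i ` {1..r i}. f v) = (\<Sum>m\<in>{1..r i}. f (Leaf i m))"
      by (subst sum.reindex) (auto simp: inj_on_def)
    finally show "(\<Sum>v\<in>insert (Inner i) (Leaf i ` {1..r i}). f v) = f (Inner i) + (\<Sum>m\<in>{1..r i}. f (Leaf i m))" .
  qed
  finally show ?thesis .
qed

lemma Zcnt_0: "Zcnt z0 X 0 \<omega> v = z0 v"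
  by (simp add: Zcnt_def)

lemma Zcnt_Suc: "Zcnt z0 X (Suc n) \<omega> v = Zcnt z0 X n \<omega> v + of_bool (X (Suc n) \<omega> = v)"
proof -
  have "{s \<in> {1..Suc n}. X s \<omega> = v} = {s \<in> {1..n}. X s \<omega> = v} \<union> (if X (Suc n) \<omega> = v then {Suc n} else {})"
    by (auto simp: le_Suc_eq)
  then show ?thesis by (auto simp: Zcnt_def)
qed

locale vrrw_complete_like = vrrw_process +
  assumes d3: "3 \<le> d" and z0_pos: "\<forall>v\<in>verts d r. 0 < z0 v"
begin

section \<open>Weights, indicators and transitions on a good path\<close>

definition Zr :: "'a \<Rightarrow> nat \<Rightarrow> nat \<Rightarrow> real" where
  "Zr \<omega> k i = real (Zcnt z0 X k \<omega> (Inner i))"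

definition Lr :: "'a \<Rightarrow> nat \<Rightarrow> nat \<Rightarrow> real" where
  "Lr \<omega> k i = (\<Sum>m\<in>{1..r i}. real (Zcnt z0 X k \<omega> (Leaf i m)))"

definition leaves :: "nat \<Rightarrow> vtx set" where
  "leaves i = Leaf i ` {1..r i}"

text \<open>Membership in a singleton makes this literally the indicator occurring in
  \<open>compensated {Inner i}\<close>.\<close>

definition Ar :: "'a \<Rightarrow> nat \<Rightarrow> nat \<Rightarrow> real" where
  "Ar \<omega> k i = of_bool (X k \<omega> \<in> {Inner i})"

definition Br :: "'a \<Rightarrow> nat \<Rightarrow> nat \<Rightarrow> real" where
  "Br \<omega> k i = of_bool (X k \<omega> \<in> leaves i)"

text \<open>Deterministic, so it enters adapted coefficients as a constant; on a good path it agrees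
  with \<open>walk_path.T\<close>.\<close>

definition tau :: "nat \<Rightarrow> real" where
  "tau k = real (tzero d r z0 + k)"

definition good_path :: "'a \<Rightarrow> bool" where
  "good_path \<omega> \<longleftrightarrow> (\<forall>n. X n \<omega> \<in> verts d r) \<and> (\<forall>n. adj (X n \<omega>) (X (Suc n) \<omega>))"

lemma Zhist_hist: "Zhist z0 (hist n \<omega>) v = Zcnt z0 X n \<omega> v"
proof (induction n)
  case 0
  then show ?case by (simp add: Zhist_def hist_def Zcnt_0)
next
  case (Suc n)
  have "hist (Suc n) \<omega> = hist n \<omega> @ [X (Suc n) \<omega>]" "hist n \<omega> \<noteq> []" by (simp_all add: hist_def)
  then show ?case using Suc by (simp add: Zhist_def Zcnt_Suc)
qed

lemma adapted_Zcnt: "adapted k (\<lambda>\<omega>. real (Zcnt z0 X k \<omega> v))"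
  unfolding adapted_def
proof (intro allI impI)
  fix \<omega> \<omega>' assume "\<forall>s\<le>k. X s \<omega> = X s \<omega>'"
  then have "{s \<in> {1..k}. X s \<omega> = v} = {s \<in> {1..k}. X s \<omega>' = v}" by auto
  then show "real (Zcnt z0 X k \<omega> v) = real (Zcnt z0 X k \<omega>' v)" by (simp add: Zcnt_def)
qed

lemma Lr_Suc: "Lr \<omega> (Suc k) i = Lr \<omega> k i + Br \<omega> (Suc k) i"
proof -
  have "(\<Sum>m\<in>{1..r i}. of_bool (X (Suc k) \<omega> = Leaf i m)) = (of_bool (X (Suc k) \<omega> \<in> leaves i) :: real)"
  proof (cases "X (Suc k) \<omega> \<in> leaves i")
    case True
    then obtain m where m: "m \<in> {1..r i}" "X (Suc k) \<omega> = Leaf i m" by (auto simp: leaves_def)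
    then have "(\<Sum>m'\<in>{1..r i}. of_bool (X (Suc k) \<omega> = Leaf i m')) = (\<Sum>m'\<in>{1..r i}. if m' = m then 1 else 0 :: real)"
      by (intro sum.cong) auto
    then show ?thesis using m True by simp
  next
    case False
    then show ?thesis by (auto simp: leaves_def intro!: sum.neutral)
  qed
  then show ?thesis by (simp add: Lr_def Br_def Zcnt_Suc sum.distrib)
qed

lemma Zr_Suc: "Zr \<omega> (Suc k) i = Zr \<omega> k i + Ar \<omega> (Suc k) i"
  by (simp add: Zr_def Ar_def Zcnt_Suc)

lemma Lr_0: "i \<in> {1..d} \<Longrightarrow> 1 \<le> r i \<Longrightarrow> 1 \<le> Lr \<omega> 0 i"
proof -
  assume i: "i \<in> {1..d}" "1 \<le> r i"
  then have "0 < z0 (Leaf i 1)" using z0_pos by (auto simp: verts_def)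
  then have "1 \<le> real (z0 (Leaf i 1))" by simp
  also have "\<dots> \<le> Lr \<omega> 0 i"
    using i unfolding Lr_def Zcnt_0 by (intro member_le_sum[where f = "\<lambda>m. real (z0 (Leaf i m))"]) auto
  finally show ?thesis .
qed

lemma good_path_cases:
  assumes "good_path \<omega>"
  obtains (inner) i where "i \<in> {1..d}" "X k \<omega> = Inner i" | (leaf) i m where "i \<in> {1..d}" "m \<in> {1..r i}" "X k \<omega> = Leaf i m"
proof -
  have "X k \<omega> \<in> verts d r" using assms by (simp add: good_path_def)
  then show ?thesis using that by (auto simp: verts_def)
qed

lemma sum_Ar_Br:
  assumes "good_path \<omega>"
  shows "(\<Sum>i\<in>{1..d}. Ar \<omega> k i + Br \<omega> k i) = 1"
proof -
  have "\<exists>j\<in>{1..d}. \<forall>i. Ar \<omega> k i + Br \<omega> k i = (if i = j then 1 else 0)"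
    using assms
  proof (cases rule: good_path_cases[of _ k])
    case (inner j)
    then show ?thesis by (intro bexI[of _ j]) (auto simp: Ar_def Br_def leaves_def)
  next
    case (leaf j m)
    then show ?thesis by (intro bexI[of _ j]) (auto simp: Ar_def Br_def leaves_def)
  qed
  then obtain j where "j \<in> {1..d}" "\<And>i. Ar \<omega> k i + Br \<omega> k i = (if i = j then 1 else 0)" by blast
  then show ?thesis by simp
qed

lemma walk_path_good:
  assumes good: "good_path \<omega>"
  shows "walk_path d (Zr \<omega>) (Lr \<omega>) (Ar \<omega>) (Br \<omega>)"
proof
  have step: "adj (X k \<omega>) (X (Suc k) \<omega>)" for k using good by (simp add: good_path_def)
  show "1 \<le> Zr \<omega> 0 i" if "i \<in> {1..d}" for i
  proof -
    have "0 < z0 (Inner i)" using that z0_pos by (auto simp: verts_def)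
    then show ?thesis by (simp add: Zr_def Zcnt_0)
  qed
  show "1 \<le> Lr \<omega> 0 i \<or> (\<forall>k. Lr \<omega> k i = 0)" if "i \<in> {1..d}" for i
    using Lr_0[OF that, of \<omega>] by (cases "r i") (auto simp: Lr_def)
  show "Br \<omega> (Suc k) i \<le> Ar \<omega> k i" for k i
  proof (cases "X (Suc k) \<omega> \<in> leaves i")
    case True
    then have "X k \<omega> = Inner i" using step[of k] by (cases "X k \<omega>") (auto simp: leaves_def)
    then show ?thesis by (simp add: Ar_def Br_def)
  qed (simp add: Br_def Ar_def)
  show "Ar \<omega> (Suc k) i \<le> Br \<omega> k i + (\<Sum>m\<in>{1..d} - {i}. Ar \<omega> k m)" for k i
  proof (cases "X (Suc k) \<omega> = Inner i")
    case True
    show ?thesis using good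
    proof (cases rule: good_path_cases[of _ k])
      case (inner j)
      then have "j \<noteq> i" using step[of k] True by auto
      then have "Ar \<omega> k j \<le> (\<Sum>m\<in>{1..d} - {i}. Ar \<omega> k m)"
        using inner by (intro member_le_sum) (auto simp: Ar_def)
      then show ?thesis using inner True by (simp add: Ar_def Br_def)
    next
      case (leaf j m)
      then have "j = i" using step[of k] True by auto
      then have "Br \<omega> k i = 1" using leaf by (auto simp: Br_def leaves_def)
      moreover have "0 \<le> (\<Sum>m\<in>{1..d} - {i}. Ar \<omega> k m)" by (intro sum_nonneg) (simp add: Ar_def)
      ultimately show ?thesis by (simp add: Ar_def)
    qed
  next
    case False
    have "0 \<le> Br \<omega> k i + (\<Sum>m\<in>{1..d} - {i}. Ar \<omega> k m)"
      by (intro add_nonneg_nonneg sum_nonneg) (simp_all add: Ar_def Br_def)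
    then show ?thesis using False by (simp add: Ar_def)
  qed
qed (use d3 sum_Ar_Br[OF good] in \<open>auto simp: Zr_Suc Lr_Suc, auto simp: Ar_def Br_def\<close>)

lemma T_eq_tau:
  assumes good: "good_path \<omega>"
  shows "walk_path.T d (Zr \<omega>) (Lr \<omega>) k = tau k"
proof -
  interpret walk_path d "Zr \<omega>" "Lr \<omega>" "Ar \<omega>" "Br \<omega>" by (rule walk_path_good[OF good])
  have "T 0 = tau 0" by (simp add: T_def tau_def tzero_def sum_verts Zr_def Lr_def Zcnt_0 sum.distrib)
  then show ?thesis by (induction k) (simp_all add: T_Suc tau_def)
qed

lemma neighbour_weight:
  assumes good: "good_path \<omega>" and i: "i \<in> {1..d}"
  shows "(\<Sum>y\<in>{y \<in> verts d r. adj (Inner i) y}. real (Zcnt z0 X k \<omega> y)) = walk_path.N d (Zr \<omega>) (Lr \<omega>) k i"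
    and "(\<Sum>y\<in>{y \<in> verts d r. adj (Leaf i m) y}. real (Zcnt z0 X k \<omega> y)) = Zr \<omega> k i"
proof -
  interpret walk_path d "Zr \<omega>" "Lr \<omega>" "Ar \<omega>" "Br \<omega>" by (rule walk_path_good[OF good])
  have "{y \<in> verts d r. adj (Inner i) y} = Inner ` ({1..d} - {i}) \<union> Leaf i ` {1..r i}"
    using i by (auto simp: verts_def)
  moreover have "(\<Sum>y\<in>Inner ` ({1..d} - {i}) \<union> Leaf i ` {1..r i}. real (Zcnt z0 X k \<omega> y))
      = (\<Sum>y\<in>Inner ` ({1..d} - {i}). real (Zcnt z0 X k \<omega> y)) + (\<Sum>y\<in>Leaf i ` {1..r i}. real (Zcnt z0 X k \<omega> y))"
    by (intro sum.union_disjoint) auto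
  moreover have "(\<Sum>y\<in>Inner ` ({1..d} - {i}). real (Zcnt z0 X k \<omega> y)) = (\<Sum>j\<in>{1..d} - {i}. Zr \<omega> k j)"
    by (subst sum.reindex) (auto simp: inj_on_def Zr_def)
  moreover have "(\<Sum>y\<in>Leaf i ` {1..r i}. real (Zcnt z0 X k \<omega> y)) = Lr \<omega> k i"
    by (subst sum.reindex) (auto simp: inj_on_def Lr_def)
  ultimately show "(\<Sum>y\<in>{y \<in> verts d r. adj (Inner i) y}. real (Zcnt z0 X k \<omega> y)) = N k i"
    by (simp add: N_def)
  have "{y \<in> verts d r. adj (Leaf i m) y} = {Inner i}"
  proof
    show "{y \<in> verts d r. adj (Leaf i m) y} \<subseteq> {Inner i}"
    proof
      fix y assume "y \<in> {y \<in> verts d r. adj (Leaf i m) y}"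
      then show "y \<in> {Inner i}" by (cases y) auto
    qed
  qed (use i in \<open>auto simp: verts_def\<close>)
  then show "(\<Sum>y\<in>{y \<in> verts d r. adj (Leaf i m) y}. real (Zcnt z0 X k \<omega> y)) = Zr \<omega> k i"
    by (simp add: Zr_def)
qed

text \<open>The factor \<open>Zr\<close> is kept in front so that division by it yields the
  compensator of \<open>inner_mart\<close>. Only the vertex or leaf set where the walk stands
  contributes to the bracket.\<close>

lemma pstep_inner:
  assumes good: "good_path \<omega>" and i: "i \<in> {1..d}"
  shows "pstep {Inner i} k \<omega> = Zr \<omega> k i *
    ((\<Sum>m\<in>{1..d} - {i}. Ar \<omega> k m / walk_path.N d (Zr \<omega>) (Lr \<omega>) k m) + Br \<omega> k i / Zr \<omega> k i)"
proof -
  have v: "verts d r \<inter> {Inner i} = {Inner i}" using i by (auto simp: verts_def)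
  have p: "pstep {Inner i} k \<omega> = (if adj (X k \<omega>) (Inner i) then Zr \<omega> k i / (\<Sum>y\<in>{y \<in> verts d r. adj (X k \<omega>) y}. real (Zcnt z0 X k \<omega> y)) else 0)"
    using i by (auto simp: pstep_def v vrrw_trans_def Zhist_hist Zr_def verts_def)
  show ?thesis using good
  proof (cases rule: good_path_cases[of _ k])
    case (inner j)
    have B: "Br \<omega> k i = 0" using inner by (auto simp: Br_def leaves_def)
    have "(\<Sum>m\<in>{1..d} - {i}. Ar \<omega> k m / walk_path.N d (Zr \<omega>) (Lr \<omega>) k m)
      = (\<Sum>m\<in>{1..d} - {i}. if m = j then 1 / walk_path.N d (Zr \<omega>) (Lr \<omega>) k j else 0)"
      using inner by (intro sum.cong) (auto simp: Ar_def)
    then have A: "(\<Sum>m\<in>{1..d} - {i}. Ar \<omega> k m / walk_path.N d (Zr \<omega>) (Lr \<omega>) k m)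
      = (if j = i then 0 else 1 / walk_path.N d (Zr \<omega>) (Lr \<omega>) k j)"
      using inner by simp
    show ?thesis unfolding p A B using inner neighbour_weight(1)[OF good inner(1)] by simp
  next
    case (leaf j m)
    have A: "(\<Sum>m\<in>{1..d} - {i}. Ar \<omega> k m / walk_path.N d (Zr \<omega>) (Lr \<omega>) k m) = 0"
      using leaf by (intro sum.neutral) (simp add: Ar_def)
    have B: "Br \<omega> k i = of_bool (j = i)" using leaf by (auto simp: Br_def leaves_def)
    show ?thesis unfolding p A B using leaf neighbour_weight(2)[OF good leaf(1)] by simp
  qed
qed

lemma pstep_leaves:
  assumes good: "good_path \<omega>" and i: "i \<in> {1..d}"
  shows "pstep (leaves i) k \<omega> = Ar \<omega> k i * Lr \<omega> k i / walk_path.N d (Zr \<omega>) (Lr \<omega>) k i"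
proof -
  have v: "verts d r \<inter> leaves i = Leaf i ` {1..r i}" using i by (auto simp: verts_def leaves_def)
  have "pstep (leaves i) k \<omega> = (\<Sum>m\<in>{1..r i}. vrrw_trans d r z0 (hist k \<omega>) (Leaf i m))"
    unfolding pstep_def v by (subst sum.reindex) (auto simp: inj_on_def)
  also have "\<dots> = (\<Sum>m\<in>{1..r i}. if X k \<omega> = Inner i
      then real (Zcnt z0 X k \<omega> (Leaf i m)) / walk_path.N d (Zr \<omega>) (Lr \<omega>) k i else 0)"
  proof (rule sum.cong)
    fix m assume m: "m \<in> {1..r i}"
    have "Leaf i m \<in> verts d r" using m i by (auto simp: verts_def)
    moreover have "adj (X k \<omega>) (Leaf i m) \<longleftrightarrow> X k \<omega> = Inner i" by (cases "X k \<omega>") auto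
    ultimately show "vrrw_trans d r z0 (hist k \<omega>) (Leaf i m) = (if X k \<omega> = Inner i
      then real (Zcnt z0 X k \<omega> (Leaf i m)) / walk_path.N d (Zr \<omega>) (Lr \<omega>) k i else 0)"
      using neighbour_weight(1)[OF good i, of k] by (auto simp: vrrw_trans_def Zhist_hist)
  qed simp
  also have "\<dots> = Ar \<omega> k i * Lr \<omega> k i / walk_path.N d (Zr \<omega>) (Lr \<omega>) k i"
    by (simp add: Ar_def Lr_def sum_divide_distrib)
  finally show ?thesis .
qed

lemma AE_good_path: "AE \<omega> in M. good_path \<omega>"
  using AE_path by (simp add: good_path_def)

lemma adapted_Zr: "adapted k (\<lambda>\<omega>. Zr \<omega> k i)" and adapted_Lr: "adapted k (\<lambda>\<omega>. Lr \<omega> k i)"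
  unfolding Zr_def Lr_def by (intro adapted_Zcnt adapted_sum)+

section \<open>Quadratic bounds for the three compensated sums\<close>

text \<open>The quadratic sum is that of \<open>1 / Z^2\<close> over the visits to \<open>i\<close>,
  at most 2 on every good path by \<open>unit_step_ln_bounds\<close>.\<close>

lemma AE_inner_bounded:
  assumes i: "i \<in> {1..d}"
  shows "AE \<omega> in M. \<exists>K. \<forall>n. \<bar>compensated {Inner i} (\<lambda>k \<omega>. 1 / Zr \<omega> k i) n \<omega>\<bar> \<le> K"
proof (rule compensated_AE_bounded[where C = 2])
  show "adapted k (\<lambda>\<omega>. 1 / Zr \<omega> k i)" for k
    by (rule adapted_binop[OF adapted_Zr adapted_Zr, where F = "\<lambda>x y. 1 / x"])
  show "AE \<omega> in M. \<forall>n. (\<Sum>k<n. (1 / Zr \<omega> k i)\<^sup>2 * of_bool (X (Suc k) \<omega> \<in> {Inner i})) \<le> 2"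
    using AE_good_path
  proof eventually_elim
    case (elim \<omega>)
    interpret walk_path d "Zr \<omega>" "Lr \<omega>" "Ar \<omega>" "Br \<omega>" by (rule walk_path_good[OF elim])
    show ?case
      using unit_step_ln_bounds(4)[of "\<lambda>k. Zr \<omega> k i" "\<lambda>k. Ar \<omega> (Suc k) i"] Zr_Suc A01 Z_0[OF i]
      by (simp add: Ar_def power_divide)
  qed
qed

lemma AE_leaf_bounded:
  assumes i: "i \<in> {1..d}" "1 \<le> r i"
  shows "AE \<omega> in M. \<exists>K. \<forall>n. \<bar>compensated (leaves i) (\<lambda>k \<omega>. 1 / Lr \<omega> k i) n \<omega>\<bar> \<le> K"
proof (rule compensated_AE_bounded[where C = 2])
  show "adapted k (\<lambda>\<omega>. 1 / Lr \<omega> k i)" for k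
    by (rule adapted_binop[OF adapted_Lr adapted_Lr, where F = "\<lambda>x y. 1 / x"])
  show "AE \<omega> in M. \<forall>n. (\<Sum>k<n. (1 / Lr \<omega> k i)\<^sup>2 * of_bool (X (Suc k) \<omega> \<in> leaves i)) \<le> 2"
    using AE_good_path
  proof eventually_elim
    case (elim \<omega>)
    interpret walk_path d "Zr \<omega>" "Lr \<omega>" "Ar \<omega>" "Br \<omega>" by (rule walk_path_good[OF elim])
    show ?case
      using unit_step_ln_bounds(4)[of "\<lambda>k. Lr \<omega> k i" "\<lambda>k. Br \<omega> (Suc k) i"] Lr_Suc B01 Lr_0[OF i]
      by (simp add: Br_def power_divide)
  qed
qed

lemma AE_leaf_tau_bounded:
  assumes i: "i \<in> {1..d}"
  shows "AE \<omega> in M. \<exists>K. \<forall>n. \<bar>compensated (leaves i) (\<lambda>k \<omega>. Lr \<omega> k i / (tau k)\<^sup>2) n \<omega>\<bar> \<le> K"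
proof (rule compensated_AE_bounded[where C = 2])
  show "adapted k (\<lambda>\<omega>. Lr \<omega> k i / (tau k)\<^sup>2)" for k
    by (rule adapted_binop[OF adapted_Lr adapted_Lr, where F = "\<lambda>x y. x / (tau k)\<^sup>2"])
  show "AE \<omega> in M. \<forall>n. (\<Sum>k<n. (Lr \<omega> k i / (tau k)\<^sup>2)\<^sup>2 * of_bool (X (Suc k) \<omega> \<in> leaves i)) \<le> 2"
    using AE_good_path
  proof eventually_elim
    case (elim \<omega>)
    interpret walk_path d "Zr \<omega>" "Lr \<omega>" "Ar \<omega>" "Br \<omega>" by (rule walk_path_good[OF elim])
    have "(\<Sum>k<n. (Lr \<omega> k i / (tau k)\<^sup>2)\<^sup>2 * of_bool (X (Suc k) \<omega> \<in> leaves i)) \<le> (\<Sum>k<n. 1 / (T k)\<^sup>2)" for n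
    proof (rule sum_mono)
      fix k
      \<comment> \<open>Since \<open>L <= T\<close>, the squared coefficient is at most
        \<open>1 / T^2\<close>, whose sum is at most 2.\<close>
      have "(Lr \<omega> k i / (T k)\<^sup>2)\<^sup>2 \<le> (1 / T k)\<^sup>2"
      proof (rule power_mono)
        have "Lr \<omega> k i / (T k)\<^sup>2 \<le> T k / (T k)\<^sup>2" by (intro divide_right_mono L_le_T i) simp
        then show "Lr \<omega> k i / (T k)\<^sup>2 \<le> 1 / T k" by (simp add: power2_eq_square)
        show "0 \<le> Lr \<omega> k i / (T k)\<^sup>2" using L_nonneg[OF i, of k] by simp
      qed
      then show "(Lr \<omega> k i / (tau k)\<^sup>2)\<^sup>2 * of_bool (X (Suc k) \<omega> \<in> leaves i) \<le> 1 / (T k)\<^sup>2"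
        by (simp add: T_eq_tau[OF elim] power_divide)
    qed
    then show ?case using sum_inverse_T_squares by (meson order_trans)
  qed
qed

lemma AE_typical_path: "AE \<omega> in M. good_path \<omega> \<and> typical_path d (Zr \<omega>) (Lr \<omega>) (Ar \<omega>) (Br \<omega>)"
proof -
  have "AE \<omega> in M. \<forall>i\<in>{1..d}.
      (\<exists>K. \<forall>n. \<bar>compensated {Inner i} (\<lambda>k \<omega>. 1 / Zr \<omega> k i) n \<omega>\<bar> \<le> K) \<and>
      (1 \<le> r i \<longrightarrow> (\<exists>K. \<forall>n. \<bar>compensated (leaves i) (\<lambda>k \<omega>. 1 / Lr \<omega> k i) n \<omega>\<bar> \<le> K)) \<and>
      (\<exists>K. \<forall>n. \<bar>compensated (leaves i) (\<lambda>k \<omega>. Lr \<omega> k i / (tau k)\<^sup>2) n \<omega>\<bar> \<le> K)"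
    using AE_inner_bounded AE_leaf_bounded AE_leaf_tau_bounded
    by (intro AE_finite_allI AE_conjI) auto
  with AE_good_path show ?thesis
  proof eventually_elim
    case (elim \<omega>)
    interpret walk_path d "Zr \<omega>" "Lr \<omega>" "Ar \<omega>" "Br \<omega>" by (rule walk_path_good[OF elim(1)])
    have "typical_path d (Zr \<omega>) (Lr \<omega>) (Ar \<omega>) (Br \<omega>)"
    proof
      fix i assume i: "i \<in> {1..d}"
      have Z: "Zr \<omega> k i \<noteq> 0" for k using Z_ge1[OF i, of k] by linarith
      \<comment> \<open>Division by the nonzero weight cancels the factor \<open>Zr\<close> in
        \<open>pstep_inner\<close>.\<close>
      have eq: "compensated {Inner i} (\<lambda>k \<omega>. 1 / Zr \<omega> k i) n \<omega> = (\<Sum>k<n. Ar \<omega> (Suc k) i / Zr \<omega> k i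
         - ((\<Sum>m\<in>{1..d} - {i}. Ar \<omega> k m / N k m) + Br \<omega> k i / Zr \<omega> k i))" for n
        unfolding compensated_def pstep_inner[OF elim(1) i] Ar_def[symmetric]
        using Z by (intro sum.cong) (auto simp: right_diff_distrib)
      show "\<exists>C. \<forall>n. \<bar>\<Sum>k<n. Ar \<omega> (Suc k) i / Zr \<omega> k i
         - ((\<Sum>m\<in>{1..d} - {i}. Ar \<omega> k m / N k m) + Br \<omega> k i / Zr \<omega> k i)\<bar> \<le> C"
        unfolding eq[symmetric] using elim(2) i by blast
      have eq_T: "compensated (leaves i) (\<lambda>k \<omega>. Lr \<omega> k i / (tau k)\<^sup>2) n \<omega>
         = (\<Sum>k<n. Lr \<omega> k i / (T k)\<^sup>2 * (Br \<omega> (Suc k) i - Ar \<omega> k i * Lr \<omega> k i / N k i))" for n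
        unfolding compensated_def pstep_leaves[OF elim(1) i] Br_def T_eq_tau[OF elim(1)] ..
      show "\<exists>C. \<forall>n. \<bar>\<Sum>k<n. Lr \<omega> k i / (T k)\<^sup>2 * (Br \<omega> (Suc k) i - Ar \<omega> k i * Lr \<omega> k i / N k i)\<bar> \<le> C"
        unfolding eq_T[symmetric] using elim(2) i by blast
    next
      fix i assume i: "i \<in> {1..d}" and L0: "1 \<le> Lr \<omega> 0 i"
      then have "1 \<le> r i" by (cases "r i") (auto simp: Lr_def)
      have "1 \<le> Lr \<omega> k i" for k
        using unit_step_ln_bounds(1)[of "\<lambda>k. Lr \<omega> k i" "\<lambda>k. Br \<omega> (Suc k) i"] L0 Lr_Suc B01 by blast
      then have L: "Lr \<omega> k i \<noteq> 0" for k by (smt (verit))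
      have eq: "compensated (leaves i) (\<lambda>k \<omega>. 1 / Lr \<omega> k i) n \<omega> = (\<Sum>k<n. Br \<omega> (Suc k) i / Lr \<omega> k i - Ar \<omega> k i / N k i)" for n
        unfolding compensated_def pstep_leaves[OF elim(1) i] Br_def[symmetric]
        using L by (intro sum.cong) (auto simp: right_diff_distrib)
      show "\<exists>C. \<forall>n. \<bar>\<Sum>k<n. Br \<omega> (Suc k) i / Lr \<omega> k i - Ar \<omega> k i / N k i\<bar> \<le> C"
        unfolding eq[symmetric] using elim(2) i \<open>1 \<le> r i\<close> by blast
    qed
    with elim(1) show ?case by blast
  qed
qed

section \<open>Limit of the occupation measure\<close>

lemma AE_occ_tendsto: "AE \<omega> in M. \<forall>v. (\<lambda>n. occ d r z0 X n \<omega> v) \<longlonglongrightarrow> pi_unif d v"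
  using AE_typical_path
proof eventually_elim
  case (elim \<omega>)
  interpret typical_path d "Zr \<omega>" "Lr \<omega>" "Ar \<omega>" "Br \<omega>" using elim by blast
  have T: "T = tau" using T_eq_tau elim by blast
  show ?case
  proof
    fix v
    show "(\<lambda>n. occ d r z0 X n \<omega> v) \<longlonglongrightarrow> pi_unif d v"
    proof (cases "v \<in> verts d r")
      case False
      then show ?thesis by (cases v) (auto simp: occ_def pi_unif_def verts_def)
    next
      case v: True
      show ?thesis
      proof (cases v)
        case (Inner i)
        then have i: "i \<in> {1..d}" using v by (auto simp: verts_def)
        then show ?thesis
          using inner_proportion_tendsto[OF i] v Inner by (simp add: T occ_def pi_unif_def Zr_def tau_def)
      next
        case (Leaf i m)
        then have i: "i \<in> {1..d}" "m \<in> {1..r i}" using v by (auto simp: verts_def)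
        have "(\<lambda>n. occ d r z0 X n \<omega> v) \<longlonglongrightarrow> 0"
        \<comment> \<open>A single leaf is dominated by the total leaf weight at its interior
          vertex.\<close>
        proof (rule tendsto_sandwich[OF _ _ tendsto_const leaf_proportion_tendsto[OF i(1)]])
          have "real (Zcnt z0 X n \<omega> v) \<le> Lr \<omega> n i" for n
            unfolding Lr_def Leaf using i(2) by (intro member_le_sum[where f = "\<lambda>m. real (Zcnt z0 X n \<omega> (Leaf i m))"]) auto
          then show "\<forall>\<^sub>F n in sequentially. occ d r z0 X n \<omega> v \<le> Lr \<omega> n i / T n"
            unfolding T tau_def occ_def by (intro always_eventually allI) (simp add: v divide_right_mono)
        qed (simp add: occ_def)
        then show ?thesis by (simp add: pi_unif_def Leaf)
      qed
    qed
  qed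
qed

end

text \<open>Coordinatewise uniqueness of limits makes the definite description in
  \<open>pi_inf\<close> single out \<open>L\<close>.\<close>

lemma pi_inf_eqI:
  assumes "\<forall>v. (\<lambda>n. occ d r z0 X n \<omega> v) \<longlonglongrightarrow> L v"
  shows "pi_inf d r z0 X \<omega> = L"
proof -
  have "(THE L. \<forall>v. (\<lambda>n. occ d r z0 X n \<omega> v) \<longlonglongrightarrow> L v) = L"
    using assms by (intro the_equality ext) (auto intro: LIMSEQ_unique)
  then show ?thesis using assms by (auto simp: pi_inf_def)
qed

theorem theorem1:
  fixes M :: "'w measure" and d :: nat and r :: "nat \<Rightarrow> nat"
    and z0 :: "vtx \<Rightarrow> nat" and x0 :: vtx and X :: "nat \<Rightarrow> 'w \<Rightarrow> vtx"
  assumes "prob_space M"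
    and "d \<ge> 3"
    and "\<forall>v\<in>verts d r. z0 v > 0"
    and "x0 \<in> verts d r"
    and "vrrw_law M d r z0 x0 X"
  shows "AE \<omega> in M. pi_inf d r z0 X \<omega> = pi_unif d"
proof -
  interpret prob_space M by fact
  interpret vrrw_complete_like M d r z0 x0 X by unfold_locales fact+
  show ?thesis using AE_occ_tendsto by eventually_elim (rule pi_inf_eqI)
qed

end
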